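(* Let $f(n)$ be the number of permutations $w\in\mathfrak S_n$ such that both $w$ and $w^{-1}$ are alternating, and let $f^*(n)$ be the number of $w\in\mathfrak S_n$ such that $w$ is alternating and $w^{-1}$ is reverse alternating. Let $L(t)=\frac12\log\frac{1+t}{1-t}=t+\frac{t^3}{3}+\frac{t^5}{5}+\cdots$. Then $$\sum_{k\ge0}f(2k+1)t^{2k+1}=\sum_{r\ge0}E_{2r+1}^2\frac{L(t)^{2r+1}}{(2r+1)!},\qquad f^*(2k+1)=f(2k+1),$$ $$\sum_{k\ge0}f(2k)t^{2k}=\frac{1}{\sqrt{1-t^2}}\sum_{r\ge0}E_{2r}^2\frac{L(t)^{2r}}{(2r)!},\qquad f^*(2k)=f(2k)-f(2k-2).$$
   Context: A permutation $w=a_1a_2\cdots a_n\in\mathfrak S_n$ is alternating if $a_1>a_2<a_3>a_4<\cdots$ and reverse alternating if $a_1<a_2>a_3<a_4>\cdots$. The Euler numbers $E_n$ are defined by $\sum_{n\ge0}E_nx^n/n!=\sec x+\tan x$ (so $E_n$ is the number of alternating permutations in $\mathfrak S_n$). *)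

theory Defs
  imports
    "HOL-Computational_Algebra.Formal_Power_Series"
    "HOL-Combinatorics.Permutations"
begin

(* A permutation w in S_n is a function w permuting {1..n}, and its one-line notation is
   a_i = w i. *)

definition alternating :: "nat \<Rightarrow> (nat \<Rightarrow> nat) \<Rightarrow> bool" where
  "alternating n w \<longleftrightarrow>
     (\<forall>i. 1 \<le> i \<and> i < n \<longrightarrow> (if odd i then w i > w (i + 1) else w i < w (i + 1)))"

definition reverse_alternating :: "nat \<Rightarrow> (nat \<Rightarrow> nat) \<Rightarrow> bool" where
  "reverse_alternating n w \<longleftrightarrow>
     (\<forall>i. 1 \<le> i \<and> i < n \<longrightarrow> (if odd i then w i < w (i + 1) else w i > w (i + 1)))"

definition bialt_count :: "nat \<Rightarrow> nat" where
  "bialt_count n = card {w. w permutes {1..n} \<and> alternating n w \<and> alternating n (inv w)}"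

definition bialt_count_star :: "nat \<Rightarrow> nat" where
  "bialt_count_star n = card {w. w permutes {1..n} \<and> alternating n w \<and> reverse_alternating n (inv w)}"

definition euler_number :: "nat \<Rightarrow> real" where
  "euler_number n = fact n * fps_nth (inverse (fps_cos 1) + fps_tan 1) n"

(* fps_ln 1 is the series of log (1 + t), so the logarithm of a series g with constant
   term 1 is fps_ln 1 oo (g - 1). *)
definition L_series :: "real fps" where
  "L_series = fps_const (1/2) * (fps_ln 1 oo ((1 + fps_X) / (1 - fps_X) - 1))"

lemma L_series_nth: "fps_nth L_series n = (if odd n then 1 / real n else 0)"
proof -
  define g :: "real fps" where "g = (1 + fps_X) / (1 - fps_X)"
  define P :: "real fps" where "P = Abs_fps (\<lambda>n. if odd n then 1 / real n else 0)"
  have nz: "fps_nth (1 - fps_X :: real fps) 0 \<noteq> 0" by simp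
  have nz': "(1 - fps_X :: real fps) \<noteq> 0" using nz by (metis fps_zero_nth)
  have g_eq: "g = (1 + fps_X) * inverse (1 - fps_X)"
    unfolding g_def by (rule fps_divide_unit[OF nz])
  have inv1: "inverse (1 - fps_X) * (1 - fps_X :: real fps) = 1"
    by (rule inverse_mult_eq_1[OF nz])
  have g_mult: "g * (1 - fps_X) = 1 + fps_X"
    unfolding g_eq by (simp add: mult.assoc inv1)
  have g0: "fps_nth g 0 = 1" unfolding g_eq by (simp add: fps_mult_nth_0)
  have u0: "fps_nth (g - 1) 0 = 0" by (simp add: g0)
  have "fps_deriv (g * (1 - fps_X)) = 1" unfolding g_mult by simp
  hence dg: "fps_deriv g * (1 - fps_X) = 1 + g"
    by (simp add: algebra_simps)
  have comp: "(inverse (1 + fps_X) oo (g - 1)) * g = 1"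
  proof -
    have "(inverse (1 + fps_X) * (1 + fps_X) :: real fps) = 1"
      by (rule inverse_mult_eq_1) simp
    hence "(inverse (1 + fps_X) * (1 + fps_X) oo (g - 1)) = (1 :: real fps)"
      by simp
    thus ?thesis
      by (simp add: fps_compose_mult_distrib[OF u0] fps_compose_add_distrib fps_X_fps_compose_startby0[OF u0])
  qed
  define A where "A = inverse (1 + fps_X) oo (g - 1)"
  have "fps_deriv L_series = fps_const (1/2) * (A * fps_deriv g)"
    unfolding L_series_def g_def[symmetric] A_def
    by (simp add: fps_compose_deriv[OF u0] fps_ln_deriv)
  hence "fps_deriv L_series * (1 - fps_X) * (1 + fps_X)
      = fps_const (1/2) * A * (fps_deriv g * (1 - fps_X)) * (1 + fps_X)"
    by (simp add: algebra_simps)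
  also have "\<dots> = fps_const (1/2) * A * (1 + g) * (g * (1 - fps_X))"
    unfolding dg g_mult ..
  also have "\<dots> = fps_const (1/2) * (A * g) * (1 - fps_X + g * (1 - fps_X))"
    by (simp add: algebra_simps)
  also have "\<dots> = fps_const (1/2) * (1 + 1)"
    unfolding g_mult using comp by (simp add: A_def)
  also have "\<dots> = 1" by (simp add: fps_eq_iff numeral_fps_const)
  finally have L: "fps_deriv L_series * (1 - fps_X) * (1 + fps_X) = 1" .
  have dP: "fps_deriv P = Abs_fps (\<lambda>n. if even n then 1 else 0)"
    by (simp add: fps_eq_iff P_def del: of_nat_Suc)
  have "fps_deriv P * (1 - fps_X) * (1 + fps_X) = fps_deriv P - fps_deriv P * fps_X ^ 2"
    by (simp add: algebra_simps power2_eq_square)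
  also have "\<dots> = 1"
    unfolding dP by (auto simp: fps_eq_iff fps_X_power_mult_right_nth less_2_cases_iff)
  finally have P: "fps_deriv P * (1 - fps_X) * (1 + fps_X) = 1" .
  have nz'': "(1 + fps_X :: real fps) \<noteq> 0"
    by (metis fps_X_nth fps_add_nth fps_one_nth fps_zero_nth add.right_neutral zero_neq_one)
  have "fps_deriv L_series = fps_deriv P"
    using L P nz' nz'' by (metis mult_right_cancel)
  moreover have "fps_nth L_series 0 = fps_nth P 0"
    by (simp add: L_series_def P_def)
  ultimately have LP: "L_series = P" by (simp add: fps_deriv_eq_iff)
  show ?thesis unfolding LP P_def by simp
qed

lemma fps_radical_one_minus_X_square:
  "(fps_radical root 2 (1 - fps_X\<^sup>2 :: real fps))\<^sup>2 = 1 - fps_X\<^sup>2"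
  "fps_nth (fps_radical root 2 (1 - fps_X\<^sup>2 :: real fps)) 0 = 1"
  using power_radical[of "1 - fps_X\<^sup>2 :: real fps" root 1]
  by (simp_all add: numeral_2_eq_2)

end

theory Submission
  imports Defs "HOL-Combinatorics.Multiset_Permutations"
begin

text \<open>
  Let \<open>T\<close> be the operator on functions of words that removes an initial chain of even length in all
  possible ways. Up to the sign \<open>(-1)\<^bsup>n div 2\<^esup>\<close>, the indicator of the zigzag pattern is \<open>T\<^sup>-\<^sup>1\<close> of a trivial
  function, so it is the sum of all \<open>(1 - T)\<^sup>r\<close> of that function.

  For sign weights \<open>y\<^sub>1, \<dots>, y\<^sub>l\<close>, removing \<open>l\<close> successive chains from \<open>w\<^sup>-\<^sup>1\<close> with these weights amounts,
  by standardization, to replacing \<open>w\<close> by a word over \<open>l\<close> letters with the same ascents. The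
  generating function of zigzag words is \<open>(1 - t\<^sup>2)\<^bsup>\<plusminus>l/2\<^esup> sech (b L(t))\<close> for even length and
  \<open>tanh (b L(t))\<close> for odd length, where \<open>b\<close> is the sum of the weights. Averaging over one more sign
  is \<open>T\<close> on the one side, and on the other side it is the operator
  \<open>\<Psi>(b) \<mapsto> (1 - t\<^sup>2)\<^bsup>\<plusminus>1/2\<^esup> (\<Psi>(b + 1) + \<Psi>(b - 1)) / 2\<close>, which multiplies \<open>exp (b x)\<close> by
  \<open>(1 - t\<^sup>2)\<^bsup>\<plusminus>1/2\<^esup> cosh x\<close>. Inverting it produces the second factor \<open>sech\<close> or \<open>tanh\<close>, hence the squared
  Euler numbers.
\<close>

unbundle fps_syntax

section \<open>Removal of chains\<close>

text \<open>Empty chains are allowed. Since a prefix is removed each time, iterating the operator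
  down to \<open>nil_ind\<close> cuts a word into consecutive chains, one per weight.\<close>

definition chain_op :: "('a \<Rightarrow> 'a \<Rightarrow> bool) \<Rightarrow> real \<Rightarrow> ('a list \<Rightarrow> real) \<Rightarrow> 'a list \<Rightarrow> real" where
  "chain_op R y \<Psi> v =
     (\<Sum>j\<le>length v. if successively R (take j v) then y ^ j * \<Psi> (drop j v) else 0)"

definition even_op :: "('a \<Rightarrow> 'a \<Rightarrow> bool) \<Rightarrow> ('a list \<Rightarrow> real) \<Rightarrow> 'a list \<Rightarrow> real" where
  "even_op R \<Psi> v = (chain_op R 1 \<Psi> v + chain_op R (-1) \<Psi> v) / 2"

fun zigzag :: "('a \<Rightarrow> 'a \<Rightarrow> bool) \<Rightarrow> 'a list \<Rightarrow> bool" where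
  "zigzag R (a # b # c # xs) \<longleftrightarrow> R a b \<and> \<not> R b c \<and> zigzag R (c # xs)"
| "zigzag R [a, b] \<longleftrightarrow> R a b"
| "zigzag R _ \<longleftrightarrow> True"

text \<open>The flag \<open>p\<close> selects even lengths (\<open>True\<close>) or odd lengths
  (\<open>False\<close>); the sign is what produces the cancellation in
  \<open>even_op_zigzag_sign\<close>.\<close>

definition zigzag_sign :: "('a \<Rightarrow> 'a \<Rightarrow> bool) \<Rightarrow> bool \<Rightarrow> 'a list \<Rightarrow> real" where
  "zigzag_sign R p v =
     (if even (length v) = p then (-1) ^ (length v div 2) * of_bool (zigzag R v) else 0)"

definition nil_ind :: "'a list \<Rightarrow> real" where
  "nil_ind v = of_bool (v = [])"

definition zigzag_base :: "('a \<Rightarrow> 'a \<Rightarrow> bool) \<Rightarrow> bool \<Rightarrow> 'a list \<Rightarrow> real" where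
  "zigzag_base R p v =
     (if p then nil_ind v else of_bool (odd (length v) \<and> successively R v))"

lemma even_op_eq:
  "even_op R \<Psi> v =
     (\<Sum>j\<le>length v. if even j \<and> successively R (take j v) then \<Psi> (drop j v) else 0)"
  unfolding even_op_def chain_op_def sum.distrib[symmetric] sum_divide_distrib
  by (rule sum.cong) auto

text \<open>The removed chain has length 0, 2 or at least 4. In the last case it continues with a
  nonempty even chain of \<open>xs\<close>, which explains the subtraction of \<Psi> at
  \<open>xs\<close>.\<close>

lemma even_op_Cons_Cons:
  "even_op R \<Psi> (a # b # xs) = \<Psi> (a # b # xs) +
     (if R a b then \<Psi> xs + (if xs = [] \<or> R b (hd xs) then even_op R \<Psi> xs - \<Psi> xs else 0) else 0)"
  unfolding even_op_eq
  by (cases xs) (auto simp: sum.atMost_Suc_shift simp del: sum.atMost_Suc cong: if_cong)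

text \<open>Two letters are stripped at a time. If \<open>R a b\<close> holds but \<open>R\<close>
  fails at the next step, the chains of length 0 and 2 contribute opposite signs; if
  \<open>R\<close> holds there too, the word is no zigzag and the value at \<open>xs\<close> is all
  that remains.\<close>

lemma even_op_zigzag_sign: "even_op R (zigzag_sign R p) v = zigzag_base R p v"
proof (induction v rule: induct_list012)
  case 1
  show ?case by (simp add: even_op_eq zigzag_sign_def zigzag_base_def nil_ind_def)
next
  case (2 x)
  show ?case by (simp add: even_op_eq zigzag_sign_def zigzag_base_def nil_ind_def)
next
  case (3 a b xs)
  show ?case
    unfolding even_op_Cons_Cons 3
    by (cases xs) (auto simp: zigzag_sign_def zigzag_base_def nil_ind_def)
qed

lemma chain_op_nil_ind:
  "chain_op R y nil_ind v = (if successively R v then y ^ length v else 0)"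
proof -
  have "chain_op R y nil_ind v =
      (\<Sum>j\<le>length v. if j = length v then (if successively R v then y ^ length v else 0) else 0)"
    unfolding chain_op_def by (rule sum.cong) (auto simp: nil_ind_def)
  thus ?thesis by simp
qed

text \<open>Writes the base for odd length through chain operators on \<open>nil_ind\<close>, the
  only function for which standardization is available.\<close>

lemma zigzag_base_odd:
  "zigzag_base R False v = (chain_op R 1 nil_ind v - chain_op R (-1) nil_ind v) / 2"
  by (simp add: zigzag_base_def chain_op_nil_ind)

text \<open>The term for the empty chain cancels the value at \<open>v\<close> itself, so the
  difference only involves strictly shorter suffixes.\<close>

lemma even_op_defect_vanishes:
  assumes "\<And>v. length v < r \<Longrightarrow> \<Psi> v = 0" "length v < Suc r"
  shows "\<Psi> v - even_op R \<Psi> v = 0"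
proof -
  have "(\<Sum>j\<in>{..length v} - {0}. if even j \<and> successively R (take j v) then \<Psi> (drop j v) else 0) = 0"
    using assms by (intro sum.neutral) auto
  thus ?thesis
    unfolding even_op_eq by (subst sum.remove[of _ 0]) auto
qed

abbreviation even_defect :: "('a \<Rightarrow> 'a \<Rightarrow> bool) \<Rightarrow> ('a list \<Rightarrow> real) \<Rightarrow> 'a list \<Rightarrow> real" where
  "even_defect R \<Psi> \<equiv> (\<lambda>v. \<Psi> v - even_op R \<Psi> v)"

lemma even_defect_funpow_vanishes:
  "length v < r \<Longrightarrow> (even_defect R ^^ r) \<Psi> v = 0"
proof (induction r arbitrary: v)
  case (Suc r)
  show ?case
    using even_op_defect_vanishes[of r "(even_defect R ^^ r) \<Psi>" v R] Suc by simp
qed simp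

lemma even_op_diff: "even_op R (\<lambda>v. \<Psi> v - \<Phi> v) v = even_op R \<Psi> v - even_op R \<Phi> v"
  unfolding even_op_eq sum_subtractf[symmetric] by (rule sum.cong) auto

lemma even_op_commute_defect:
  "even_op R ((even_defect R ^^ r) \<Psi>) = (even_defect R ^^ r) (even_op R \<Psi>)"
  by (induction r) (auto simp: fun_eq_iff even_op_diff)

text \<open>Finite Neumann series: \<open>even_op\<close> is the identity minus the defect, so the
  powers telescope, and power \<open>n + 1\<close> of the defect vanishes on words of length at most
  \<open>n\<close>.\<close>

lemma sum_even_defect_base:
  assumes "length v \<le> n"
  shows "(\<Sum>r\<le>n. (even_defect R ^^ r) (zigzag_base R p) v) = zigzag_sign R p v"
proof -
  have b: "zigzag_base R p = even_op R (zigzag_sign R p)"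
    by (auto simp: even_op_zigzag_sign)
  have "(\<Sum>r\<le>n. (even_defect R ^^ r) (zigzag_base R p) v) =
        (\<Sum>r\<le>n. (even_defect R ^^ r) (zigzag_sign R p) v - (even_defect R ^^ Suc r) (zigzag_sign R p) v)"
    unfolding b even_op_commute_defect[symmetric] by simp
  also have "\<dots> = zigzag_sign R p v - (even_defect R ^^ Suc n) (zigzag_sign R p) v"
    by (subst sum_telescope) simp
  also have "(even_defect R ^^ Suc n) (zigzag_sign R p) v = 0"
    using assms by (intro even_defect_funpow_vanishes) simp
  finally show ?thesis by simp
qed

section \<open>Generating functions of words\<close>

definition words :: "nat \<Rightarrow> nat \<Rightarrow> nat list set" where
  "words l n = {u. set u \<subseteq> {..<l} \<and> length u = n}"

definition word_weight :: "real list \<Rightarrow> nat list \<Rightarrow> real" where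
  "word_weight ys u = prod_list (map ((!) ys) u)"

definition word_gf :: "real list \<Rightarrow> (nat list \<Rightarrow> real) \<Rightarrow> real fps" where
  "word_gf ys \<Psi> = Abs_fps (\<lambda>n. \<Sum>u\<in>words (length ys) n. \<Psi> u * word_weight ys u)"

lemma finite_words [simp]: "finite (words l n)"
  unfolding words_def by (rule finite_lists_length_eq) simp

lemma words_0 [simp]: "words l 0 = {[]}"
  by (auto simp: words_def)

lemma word_weight_append: "word_weight ys (u @ v) = word_weight ys u * word_weight ys v"
  by (simp add: word_weight_def)

lemma sum_words_split:
  assumes "j \<le> n"
  shows "(\<Sum>u\<in>words l n. F (take j u) (drop j u)) =
         (\<Sum>p\<in>words l j. \<Sum>s\<in>words l (n - j). F p s)"
  unfolding sum.cartesian_product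
  by (rule sum.reindex_bij_witness[where j = "\<lambda>u. (take j u, drop j u)" and i = "\<lambda>(p, s). p @ s"])
     (use assms in \<open>auto simp: words_def dest: in_set_takeD in_set_dropD\<close>)

text \<open>Cutting a word behind its removed chain gives a pair of arbitrary words and weights are
  multiplicative, so the operator acts on series as a Cauchy product.\<close>

lemma word_gf_chain_op:
  "word_gf ys (chain_op R y \<Psi>) = word_gf ys (chain_op R y nil_ind) * word_gf ys \<Psi>"
proof (rule fps_ext)
  fix n
  define l where "l = length ys"
  define F where "F p s = (if successively R p then y ^ length p else 0) * word_weight ys p *
      (\<Psi> s * word_weight ys s)" for p s
  have "word_gf ys (chain_op R y \<Psi>) $ n = (\<Sum>u\<in>words l n. \<Sum>j\<le>n. F (take j u) (drop j u))"
    unfolding word_gf_def fps_nth_Abs_fps chain_op_def sum_distrib_right l_def[symmetric]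
  proof (intro sum.cong refl)
    fix u assume "u \<in> words l n"
    thus "{..length u} = {..n}" by (simp add: words_def)
  next
    fix u j assume u: "u \<in> words l n" and j: "j \<in> {..n}"
    have "word_weight ys u = word_weight ys (take j u) * word_weight ys (drop j u)"
      by (simp flip: word_weight_append)
    moreover have "length (take j u) = j" using u j by (auto simp: words_def)
    ultimately show "(if successively R (take j u) then y ^ j * \<Psi> (drop j u) else 0) * word_weight ys u
        = F (take j u) (drop j u)"
      by (simp add: F_def)
  qed
  also have "\<dots> = (\<Sum>j\<le>n. \<Sum>u\<in>words l n. F (take j u) (drop j u))"
    by (rule sum.swap)
  also have "\<dots> = (\<Sum>j\<le>n. \<Sum>p\<in>words l j. \<Sum>s\<in>words l (n - j). F p s)"
    by (intro sum.cong refl sum_words_split) auto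
  also have "\<dots> = (word_gf ys (chain_op R y nil_ind) * word_gf ys \<Psi>) $ n"
    unfolding fps_mult_nth word_gf_def fps_nth_Abs_fps chain_op_nil_ind F_def l_def atLeast0AtMost
    by (simp add: sum_product)
  finally show "word_gf ys (chain_op R y \<Psi>) $ n =
      (word_gf ys (chain_op R y nil_ind) * word_gf ys \<Psi>) $ n" .
qed

lemma word_gf_nil_ind: "word_gf ys nil_ind = 1"
proof (rule fps_ext)
  fix n show "word_gf ys nil_ind $ n = 1 $ n"
  proof (cases n)
    case (Suc m)
    thus ?thesis
      unfolding word_gf_def fps_nth_Abs_fps
      by (simp, intro sum.neutral) (auto simp: words_def nil_ind_def)
  qed (simp add: word_gf_def nil_ind_def word_weight_def)
qed

lemma word_gf_lincomb:
  "word_gf ys (\<lambda>u. (\<Psi> u + \<Phi> u) / 2) = fps_const (1/2) * (word_gf ys \<Psi> + word_gf ys \<Phi>)"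
  "word_gf ys (\<lambda>u. (\<Psi> u - \<Phi> u) / 2) = fps_const (1/2) * (word_gf ys \<Psi> - word_gf ys \<Phi>)"
  by (simp_all add: word_gf_def fps_eq_iff add_divide_distrib diff_divide_distrib distrib_right
        left_diff_distrib sum.distrib sum_subtractf flip: sum_divide_distrib)

lemma word_gf_even_op:
  "word_gf ys (even_op R \<Psi>) =
     fps_const (1/2) * (word_gf ys (chain_op R 1 nil_ind) + word_gf ys (chain_op R (-1) nil_ind))
       * word_gf ys \<Psi>"
proof -
  have "word_gf ys (even_op R \<Psi>) =
     fps_const (1/2) * (word_gf ys (chain_op R 1 \<Psi>) + word_gf ys (chain_op R (-1) \<Psi>))"
    by (simp add: even_op_def[abs_def] word_gf_lincomb)
  thus ?thesis
    by (simp add: word_gf_chain_op[of _ _ _ \<Psi>] algebra_simps)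
qed

definition chain_words :: "(nat \<Rightarrow> nat \<Rightarrow> bool) \<Rightarrow> nat \<Rightarrow> nat \<Rightarrow> nat list set" where
  "chain_words R l n = {u \<in> words l n. successively R u}"

lemma finite_chain_words [simp]: "finite (chain_words R l n)"
  by (simp add: chain_words_def)

lemma word_gf_chain_nth:
  "word_gf ys (chain_op R c nil_ind) $ n =
     c ^ n * (\<Sum>u\<in>chain_words R (length ys) n. word_weight ys u)"
proof -
  have "word_gf ys (chain_op R c nil_ind) $ n =
      (\<Sum>u\<in>words (length ys) n. if successively R u then c ^ n * word_weight ys u else 0)"
    unfolding word_gf_def fps_nth_Abs_fps chain_op_nil_ind
    by (rule sum.cong) (auto simp: words_def)
  thus ?thesis
    by (simp add: chain_words_def sum_distrib_left sum.inter_filter if_distrib cong: if_cong)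
qed

lemma word_weight_snoc:
  "u \<in> chain_words R (length ys) n \<Longrightarrow> word_weight (ys @ [z]) u = word_weight ys u"
  unfolding word_weight_def chain_words_def words_def
  by (intro arg_cong[where f = prod_list] map_cong) (auto simp: nth_append)

text \<open>A weakly increasing word containing the largest letter must end with it, and further
  copies may remain after that one is removed.\<close>

lemma chain_words_le_Suc:
  "chain_words (\<le>) (Suc l) (Suc n) =
     chain_words (\<le>) l (Suc n) \<union> (\<lambda>u. u @ [l]) ` chain_words (\<le>) (Suc l) n"
  (is "?A = ?B \<union> ?C")
proof (intro equalityI subsetI)
  fix u assume u: "u \<in> ?A"
  then obtain u' x where ux: "u = u' @ [x]"
    by (cases u rule: rev_cases) (auto simp: chain_words_def words_def)
  have s: "sorted_wrt (\<le>) u"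
    using u by (simp add: chain_words_def successively_conv_sorted_wrt)
  show "u \<in> ?B \<union> ?C"
  proof (cases "x = l")
    case True
    have "u' \<in> chain_words (\<le>) (Suc l) n"
      using u s by (auto simp: ux chain_words_def words_def successively_append_iff)
    thus ?thesis using True ux by blast
  next
    case False
    hence "x < l" using u by (auto simp: ux chain_words_def words_def)
    hence "set u \<subseteq> {..<l}" using s by (force simp: ux sorted_wrt_append)
    thus ?thesis using u by (auto simp: chain_words_def words_def)
  qed
next
  fix u assume "u \<in> ?B \<union> ?C"
  thus "u \<in> ?A"
  proof
    assume "u \<in> ?C"
    then obtain u' where u': "u = u' @ [l]" "u' \<in> chain_words (\<le>) (Suc l) n" by blast
    have "last u' \<le> l" if "u' \<noteq> []"
      using u' last_in_set[OF that] by (force simp: chain_words_def words_def)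
    thus ?thesis using u' by (auto simp: chain_words_def words_def successively_append_iff)
  qed (auto simp: chain_words_def words_def)
qed

text \<open>A strictly decreasing word contains the largest letter at most once, and then at the
  front, so the rest uses smaller letters only.\<close>

lemma chain_words_gt_Suc:
  "chain_words (>) (Suc l) (Suc n) =
     chain_words (>) l (Suc n) \<union> (#) l ` chain_words (>) l n"
  (is "?A = ?B \<union> ?C")
proof (intro equalityI subsetI)
  fix u assume u: "u \<in> ?A"
  then obtain u' x where ux: "u = x # u'"
    by (cases u) (auto simp: chain_words_def words_def)
  have s: "sorted_wrt (>) u"
    using u by (simp add: chain_words_def successively_conv_sorted_wrt transp_def)
  have x: "x \<le> l" using u by (auto simp: ux chain_words_def words_def)
  have sub: "set u' \<subseteq> {..<l}" using s x by (force simp: ux)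
  have u': "successively (>) u'" using u by (auto simp: ux chain_words_def successively_Cons)
  show "u \<in> ?B \<union> ?C"
  proof (cases "x = l")
    case True
    thus ?thesis using u u' sub by (auto simp: ux chain_words_def words_def)
  next
    case False
    thus ?thesis using u u' sub x by (auto simp: ux chain_words_def words_def)
  qed
next
  fix u assume "u \<in> ?B \<union> ?C"
  thus "u \<in> ?A"
  proof
    assume "u \<in> ?C"
    then obtain u' where u': "u = l # u'" "u' \<in> chain_words (>) l n" by blast
    have "hd u' < l" if "u' \<noteq> []"
      using u' hd_in_set[OF that] by (force simp: chain_words_def words_def)
    thus ?thesis using u' by (auto simp: chain_words_def words_def successively_Cons)
  qed (auto simp: chain_words_def words_def)
qed

text \<open>Each new letter divides by 1 - c z t, as for complete homogeneous symmetric
  functions.\<close>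

lemma word_gf_chain_le_snoc:
  "word_gf (ys @ [z]) (chain_op (\<le>) c nil_ind) * (1 - fps_const (c * z) * fps_X) =
     word_gf ys (chain_op (\<le>) c nil_ind)"
proof -
  let ?H = "\<lambda>ys. word_gf ys (chain_op (\<le>) c nil_ind)"
  let ?w = "word_weight (ys @ [z])" and ?l = "length ys"
  have "?H (ys @ [z]) $ n = (?H ys + fps_const (c * z) * (fps_X * ?H (ys @ [z]))) $ n" for n
  proof (cases n)
    case 0
    thus ?thesis by (simp add: word_gf_chain_nth chain_words_def cong: conj_cong)
                    (auto simp: word_weight_def)
  next
    case (Suc m)
    have "sum ?w (chain_words (\<le>) (Suc ?l) n) =
        sum ?w (chain_words (\<le>) ?l n) + sum ?w ((\<lambda>u. u @ [?l]) ` chain_words (\<le>) (Suc ?l) m)"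
      unfolding Suc chain_words_le_Suc
      by (rule sum.union_disjoint) (simp, simp, auto simp: chain_words_def words_def)
    also have "sum ?w (chain_words (\<le>) ?l n) = sum (word_weight ys) (chain_words (\<le>) ?l n)"
      by (intro sum.cong refl word_weight_snoc)
    also have "sum ?w ((\<lambda>u. u @ [?l]) ` chain_words (\<le>) (Suc ?l) m) =
        (\<Sum>u\<in>chain_words (\<le>) (Suc ?l) m. z * ?w u)"
      by (subst sum.reindex) (auto simp: inj_on_def word_weight_append, simp add: word_weight_def mult.commute)
    finally show ?thesis
      by (simp add: word_gf_chain_nth Suc sum_distrib_left algebra_simps)
  qed
  hence "?H (ys @ [z]) = ?H ys + fps_const (c * z) * (fps_X * ?H (ys @ [z]))"
    by (rule fps_ext)
  thus ?thesis by (simp add: algebra_simps)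
qed

text \<open>Each new letter multiplies by 1 + c z t, as for elementary symmetric functions.\<close>

lemma word_gf_chain_gt_snoc:
  "word_gf (ys @ [z]) (chain_op (>) c nil_ind) =
     word_gf ys (chain_op (>) c nil_ind) * (1 + fps_const (c * z) * fps_X)"
proof -
  let ?H = "\<lambda>ys. word_gf ys (chain_op (>) c nil_ind)"
  let ?w = "word_weight (ys @ [z])" and ?l = "length ys"
  have "?H (ys @ [z]) $ n = (?H ys + fps_const (c * z) * (fps_X * ?H ys)) $ n" for n
  proof (cases n)
    case 0
    thus ?thesis by (simp add: word_gf_chain_nth chain_words_def cong: conj_cong)
                    (auto simp: word_weight_def)
  next
    case (Suc m)
    have "sum ?w (chain_words (>) (Suc ?l) n) =
        sum ?w (chain_words (>) ?l n) + sum ?w ((#) ?l ` chain_words (>) ?l m)"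
      unfolding Suc chain_words_gt_Suc
      by (rule sum.union_disjoint) (simp, simp, auto simp: chain_words_def words_def)
    also have "sum ?w (chain_words (>) ?l n) = sum (word_weight ys) (chain_words (>) ?l n)"
      by (intro sum.cong refl word_weight_snoc)
    also have "sum ?w ((#) ?l ` chain_words (>) ?l m) =
        (\<Sum>u\<in>chain_words (>) ?l m. z * ?w u)"
      by (subst sum.reindex) (auto simp: inj_on_def, simp add: word_weight_def)
    also have "\<dots> = (\<Sum>u\<in>chain_words (>) ?l m. z * word_weight ys u)"
      by (intro sum.cong refl) (simp add: word_weight_snoc)
    finally show ?thesis
      by (simp add: word_gf_chain_nth Suc sum_distrib_left algebra_simps)
  qed
  hence "?H (ys @ [z]) = ?H ys + fps_const (c * z) * (fps_X * ?H ys)"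
    by (rule fps_ext)
  thus ?thesis by (simp add: algebra_simps)
qed

lemma word_gf_Nil_chain: "word_gf [] (chain_op R c nil_ind) = 1"
proof (rule fps_ext)
  fix n
  have "chain_words R 0 n = (if n = 0 then {[]} else {})"
    by (auto simp: chain_words_def words_def)
  thus "word_gf [] (chain_op R c nil_ind) $ n = 1 $ n"
    by (simp add: word_gf_chain_nth word_weight_def)
qed

section \<open>Standardization\<close>

text \<open>Blocks may be empty: block \<open>a\<close> will hold the positions of the letter
  \<open>a\<close>, which need not occur.\<close>

definition block_lists :: "nat \<Rightarrow> nat list \<Rightarrow> nat list list set" where
  "block_lists l v = {bs. length bs = l \<and> concat bs = v \<and> (\<forall>b\<in>set bs. sorted_wrt (<) b)}"

definition block_weight :: "real list \<Rightarrow> nat list list \<Rightarrow> real" where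
  "block_weight ys bs = prod_list (map2 (\<lambda>y b. y ^ length b) ys bs)"

lemma block_lists_0: "block_lists 0 v = (if v = [] then {[]} else {})"
  by (auto simp: block_lists_def)

lemma block_lists_Suc:
  "block_lists (Suc l) v = (\<lambda>(j, bs). take j v # bs) `
     (SIGMA j:{j. j \<le> length v \<and> sorted_wrt (<) (take j v)}. block_lists l (drop j v))"
  (is "_ = ?f ` ?S")
proof (intro equalityI subsetI)
  fix bs assume bs: "bs \<in> block_lists (Suc l) v"
  then obtain b cs where b: "bs = b # cs" by (cases bs) (auto simp: block_lists_def)
  hence "bs = ?f (length b, cs)" "(length b, cs) \<in> ?S"
    using bs by (auto simp: block_lists_def)
  thus "bs \<in> ?f ` ?S" by blast
qed (auto simp: block_lists_def)

lemma finite_block_lists: "finite (block_lists l v)"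
proof (induction l arbitrary: v)
  case (Suc l)
  have "finite {j. j \<le> length v \<and> sorted_wrt (<) (take j v)}"
    by (rule finite_subset[of _ "{..length v}"]) auto
  thus ?case unfolding block_lists_Suc using Suc by blast
qed (simp add: block_lists_0)

text \<open>Each operator cuts off one block, and the final \<open>nil_ind\<close> forces the blocks
  to exhaust the word.\<close>

lemma foldr_chain_op_eq_sum_blocks:
  "foldr (chain_op (<)) ys nil_ind v = (\<Sum>bs\<in>block_lists (length ys) v. block_weight ys bs)"
proof (induction ys arbitrary: v)
  case Nil
  show ?case by (simp add: block_lists_0 block_weight_def nil_ind_def)
next
  case (Cons y ys)
  let ?J = "{j. j \<le> length v \<and> sorted_wrt (<) (take j v)}"
  let ?S = "SIGMA j:?J. block_lists (length ys) (drop j v)"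
  have fin: "finite ?J" by (rule finite_subset[of _ "{..length v}"]) auto
  \<comment> \<open>As \<open>j\<close> is at most the length of \<open>v\<close>, it is recovered
    as the length of the first block.\<close>
  have inj: "inj_on (\<lambda>(j, bs). take j v # bs) ?S"
    by (rule inj_onI) (auto dest: arg_cong[where f = length])
  have "(\<Sum>bs\<in>block_lists (length (y # ys)) v. block_weight (y # ys) bs) =
      (\<Sum>(j, bs)\<in>?S. y ^ j * block_weight ys bs)"
    unfolding list.size(4) add_Suc_right add_0_right block_lists_Suc sum.reindex[OF inj] o_def
    by (intro sum.cong refl) (auto simp: block_weight_def)
  also have "\<dots> = (\<Sum>j\<in>?J. \<Sum>bs\<in>block_lists (length ys) (drop j v). y ^ j * block_weight ys bs)"
    using fin finite_block_lists by (subst sum.Sigma) auto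
  also have "\<dots> = (\<Sum>j\<in>?J. y ^ j * foldr (chain_op (<)) ys nil_ind (drop j v))"
    by (simp add: Cons sum_distrib_left)
  also have "\<dots> = (\<Sum>j\<in>{..length v} \<inter> {j. sorted_wrt (<) (take j v)}.
      y ^ j * foldr (chain_op (<)) ys nil_ind (drop j v))"
    by (rule sum.cong) auto
  also have "\<dots> = foldr (chain_op (<)) (y # ys) nil_ind v"
    by (simp add: chain_op_def successively_conv_sorted_wrt sum.inter_restrict)
  finally show ?case by simp
qed

text \<open>Positions are counted from 1. The concatenated blocks form the one-line word of the
  inverse of the standardization of \<open>u\<close>.\<close>

definition fibers :: "nat \<Rightarrow> nat list \<Rightarrow> nat list list" where
  "fibers l u = map (\<lambda>a. filter (\<lambda>i. u ! (i - 1) = a) [1..<Suc (length u)]) [0..<l]"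

definition standard_blocks :: "nat \<Rightarrow> nat \<Rightarrow> nat list list set" where
  "standard_blocks l n =
     {bs. length bs = l \<and> (\<forall>b\<in>set bs. sorted_wrt (<) b) \<and> concat bs \<in> permutations_of_set {1..n}}"

text \<open>A list of blocks determines the word that it cuts, so the double sum over words and
  cuttings is a single sum.\<close>

lemma sum_permutations_blocks:
  "(\<Sum>v\<in>permutations_of_set {1..n}. G v * foldr (chain_op (<)) ys nil_ind v) =
     (\<Sum>bs\<in>standard_blocks (length ys) n. G (concat bs) * block_weight ys bs)"
proof -
  have "(\<Sum>v\<in>permutations_of_set {1..n}. G v * foldr (chain_op (<)) ys nil_ind v) =
     (\<Sum>(v, bs)\<in>(SIGMA v:permutations_of_set {1..n}. block_lists (length ys) v). G v * block_weight ys bs)"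
    unfolding foldr_chain_op_eq_sum_blocks sum_distrib_left
    by (subst sum.Sigma) (auto simp: finite_block_lists)
  also have "\<dots> = (\<Sum>bs\<in>standard_blocks (length ys) n. G (concat bs) * block_weight ys bs)"
    by (rule sum.reindex_bij_witness[where i = "\<lambda>bs. (concat bs, bs)" and j = snd])
       (auto simp: standard_blocks_def block_lists_def)
  finally show ?thesis .
qed

lemma distinct_concat_nth_unique:
  assumes "distinct (concat bs)" "a < length bs" "b < length bs" "x \<in> set (bs ! a)" "x \<in> set (bs ! b)"
  shows "a = b"
  using assms
proof (induction bs arbitrary: a b)
  case (Cons c bs)
  have *: "x \<in> set (concat bs)" if "x \<in> set (bs ! k)" "k < length bs" for k
    using that by auto
  show ?case
    using Cons.prems Cons.IH * by (cases a; cases b) auto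
qed simp

lemma length_filter_nth_eq_count:
  "length (filter (\<lambda>i. u ! (i - 1) = a) [1..<Suc (length u)]) = count_list u a"
proof -
  have "filter (\<lambda>i. u ! (i - 1) = a) [1..<Suc (length u)] = map Suc (filter (\<lambda>i. u ! i = a) [0..<length u])"
    unfolding One_nat_def map_Suc_upt[symmetric] filter_map o_def by simp
  moreover have "filter ((=) a) (map ((!) u) [0..<length u]) = map ((!) u) (filter (\<lambda>i. a = u ! i) [0..<length u])"
    by (simp add: filter_map o_def)
  ultimately show ?thesis
    by (simp add: count_list_eq_length_filter map_nth) (metis (mono_tags, lifting) length_map filter_cong)
qed

lemma word_weight_eq_prod_count:
  assumes "set u \<subseteq> {..<length ys}"
  shows "word_weight ys u = (\<Prod>a<length ys. ys ! a ^ count_list u a)"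
  using assms
proof (induction u)
  case (Cons x u)
  have "(\<Prod>a<length ys. ys ! a ^ count_list (x # u) a) =
      (\<Prod>a<length ys. (if a = x then ys ! a else 1) * ys ! a ^ count_list u a)"
    by (rule prod.cong) auto
  also have "\<dots> = ys ! x * (\<Prod>a<length ys. ys ! a ^ count_list u a)"
    using Cons.prems by (simp add: prod.distrib)
  finally show ?case using Cons by (simp add: word_weight_def)
qed (simp add: word_weight_def)

lemma block_weight_fibers:
  assumes "u \<in> words (length ys) n"
  shows "block_weight ys (fibers (length ys) u) = word_weight ys u"
proof -
  have "block_weight ys (fibers (length ys) u) = (\<Prod>a<length ys. ys ! a ^ count_list u a)"
    by (simp add: block_weight_def fibers_def prod.list_conv_set_nth atLeast0LessThan
          length_filter_nth_eq_count[unfolded One_nat_def] del: upt_Suc)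
  thus ?thesis using assms by (subst word_weight_eq_prod_count) (auto simp: words_def)
qed

lemma set_concat_fibers:
  assumes "u \<in> words l n"
  shows "set (concat (fibers l u)) = {1..n}"
proof -
  have len: "length u = n" using assms by (simp add: words_def)
  have "set (concat (fibers l u)) = {i \<in> {1..n}. u ! (i - 1) < l}"
    unfolding fibers_def len by (auto simp del: upt_Suc)
  also have "u ! (i - 1) < l" if "i \<in> {1..n}" for i
  proof -
    have "u ! (i - 1) \<in> set u" using that len by auto
    thus ?thesis using assms by (auto simp: words_def)
  qed
  hence "{i \<in> {1..n}. u ! (i - 1) < l} = {1..n}" by blast
  finally show ?thesis .
qed

text \<open>This is the standardization order: by letter, ties broken by position. Induction on the
  alphabet appends the block of the largest letter.\<close>

lemma sorted_wrt_concat_fibers: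
  "sorted_wrt (\<lambda>i j. u ! (i - 1) < u ! (j - 1) \<or> u ! (i - 1) = u ! (j - 1) \<and> i < j) (concat (fibers l u))"
proof (induction l)
  case (Suc l)
  have "sorted_wrt (\<lambda>i j. u ! (i - 1) < u ! (j - 1) \<or> u ! (i - 1) = u ! (j - 1) \<and> i < j)
          (filter (\<lambda>i. u ! (i - 1) = l) [1..<Suc (length u)])"
    by (rule sorted_wrt_mono_rel[OF _ sorted_wrt_filter[OF sorted_wrt_upt]]) (auto simp del: upt_Suc)
  moreover have "fibers (Suc l) u = fibers l u @ [filter (\<lambda>i. u ! (i - 1) = l) [1..<Suc (length u)]]"
    by (simp add: fibers_def)
  moreover have "u ! (i - 1) < l" if "i \<in> set (concat (fibers l u))" for i
    using that by (auto simp: fibers_def simp del: upt_Suc)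
  ultimately show ?case using Suc by (auto simp: sorted_wrt_append simp del: upt_Suc)
qed (simp add: fibers_def)

text \<open>The standardization order is irreflexive, so no entry can occur at two places.\<close>

lemma distinct_concat_fibers: "distinct (concat (fibers l u))"
  unfolding distinct_conv_nth
proof (intro allI impI)
  let ?v = "concat (fibers l u)"
  fix p q assume pq: "p < length ?v" "q < length ?v" "p \<noteq> q"
  from pq(3) consider "p < q" | "q < p" by linarith
  thus "?v ! p \<noteq> ?v ! q"
    by cases (use pq sorted_wrt_nth_less[OF sorted_wrt_concat_fibers[of u l], of p q]
      sorted_wrt_nth_less[OF sorted_wrt_concat_fibers[of u l], of q p] in auto)
qed

lemma fibers_in_standard_blocks:
  assumes "u \<in> words l n"
  shows "fibers l u \<in> standard_blocks l n"
proof -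
  have "sorted_wrt (<) b" if "b \<in> set (fibers l u)" for b
    using that by (auto simp: fibers_def intro!: sorted_wrt_filter simp del: upt_Suc)
  thus ?thesis
    using set_concat_fibers[OF assms] distinct_concat_fibers[of l u]
    by (auto simp: standard_blocks_def permutations_of_set_def fibers_def simp del: upt_Suc)
qed

text \<open>Inverse of \<open>fibers\<close>; the description is proper on
  \<open>standard_blocks\<close>, where the blocks partition the numbers from 1 to
  \<open>n\<close>.\<close>

definition block_word :: "nat \<Rightarrow> nat list list \<Rightarrow> nat list" where
  "block_word n bs = map (\<lambda>i. THE a. a < length bs \<and> i \<in> set (bs ! a)) [1..<Suc n]"

lemma block_word_nth:
  assumes "bs \<in> standard_blocks l n" "i \<in> {1..n}" "a < l"
  shows "block_word n bs ! (i - 1) = a \<longleftrightarrow> i \<in> set (bs ! a)"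
    and "block_word n bs ! (i - 1) < l"
proof -
  have bs: "length bs = l" "distinct (concat bs)" "set (concat bs) = {1..n}"
    using assms by (auto simp: standard_blocks_def permutations_of_set_def)
  obtain b where b: "b < l" "i \<in> set (bs ! b)"
  proof -
    obtain c where "c \<in> set bs" "i \<in> set c"
      using assms(2) unfolding bs(3)[symmetric] by auto
    thus ?thesis using that bs(1) by (metis in_set_conv_nth)
  qed
  have eq: "block_word n bs ! (i - 1) = b"
  proof -
    have "(THE a. a < length bs \<and> i \<in> set (bs ! a)) = b"
      using b bs(1) distinct_concat_nth_unique[OF bs(2)] by (intro the_equality) blast+
    moreover have "i - 1 < n" "Suc (i - 1) = i" using assms(2) by auto
    ultimately show ?thesis by (simp add: block_word_def del: upt_Suc)
  qed
  show "block_word n bs ! (i - 1) = a \<longleftrightarrow> i \<in> set (bs ! a)"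
    unfolding eq using b bs assms(3) distinct_concat_nth_unique[OF bs(2)] by auto
  show "block_word n bs ! (i - 1) < l" unfolding eq by (rule b)
qed

text \<open>Corresponding blocks have the same elements and are both strictly increasing, hence they
  agree as lists.\<close>

lemma fibers_block_word:
  assumes "bs \<in> standard_blocks l n"
  shows "fibers l (block_word n bs) = bs"
proof (rule nth_equalityI)
  have l: "length bs = l" using assms by (simp add: standard_blocks_def)
  thus "length (fibers l (block_word n bs)) = length bs" by (simp add: fibers_def)
  fix a assume "a < length (fibers l (block_word n bs))"
  hence a: "a < l" by (simp add: fibers_def)
  have len: "length (block_word n bs) = n" by (simp add: block_word_def)
  have sub: "set (bs ! a) \<subseteq> {1..n}"
    using assms a nth_mem[of a bs] by (auto simp: standard_blocks_def permutations_of_set_def)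
  have "set (filter (\<lambda>i. block_word n bs ! (i - 1) = a) [1..<Suc n]) =
      {i \<in> {1..n}. block_word n bs ! (i - 1) = a}"
    by (auto simp del: upt_Suc)
  also have "\<dots> = set (bs ! a)"
    using block_word_nth(1)[OF assms _ a] sub by blast
  finally have "set (filter (\<lambda>i. block_word n bs ! (i - 1) = a) [1..<Suc n]) = set (bs ! a)" .
  moreover have "sorted_wrt (<) (bs ! a)" using assms a by (auto simp: standard_blocks_def)
  ultimately have "filter (\<lambda>i. block_word n bs ! (i - 1) = a) [1..<Suc n] = bs ! a"
    by (intro sorted_distinct_set_unique)
       (auto simp: strict_sorted_iff sorted_wrt_filter simp del: upt_Suc)
  thus "fibers l (block_word n bs) ! a = bs ! a"
    using a len by (simp add: fibers_def del: upt_Suc)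
qed

lemma block_word_fibers:
  assumes "u \<in> words l n"
  shows "block_word n (fibers l u) = u"
proof (rule nth_equalityI)
  have len: "length u = n" using assms by (simp add: words_def)
  thus "length (block_word n (fibers l u)) = length u" by (simp add: block_word_def)
  fix i assume i: "i < length (block_word n (fibers l u))"
  hence i': "Suc i \<in> {1..n}" by (auto simp: block_word_def simp del: upt_Suc)
  have "u ! i \<in> set u" using i' len by auto
  hence a: "u ! i < l" using assms by (auto simp: words_def)
  have "Suc i \<in> set (fibers l u ! (u ! i))"
    using a i' len by (auto simp: fibers_def simp del: upt_Suc)
  thus "block_word n (fibers l u) ! i = u ! i"
    using block_word_nth(1)[OF fibers_in_standard_blocks[OF assms] i' a] by simp
qed

lemma block_word_in_words:
  assumes "bs \<in> standard_blocks l n"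
  shows "block_word n bs \<in> words l n"
proof -
  have "block_word n bs ! i < l" if "i < n" for i
  proof -
    have "Suc i \<in> set (concat bs)"
      using assms that by (auto simp: standard_blocks_def permutations_of_set_def)
    \<comment> \<open>Some block exists, so 0 is an admissible index when
      \<open>block_word_nth\<close> is applied.\<close>
    hence "0 < l" using assms by (cases bs) (auto simp: standard_blocks_def)
    thus ?thesis using block_word_nth(2)[OF assms, of "Suc i" 0] that by simp
  qed
  moreover have len: "length (block_word n bs) = n" by (simp add: block_word_def)
  ultimately have "x < l" if "x \<in> set (block_word n bs)" for x
    using that by (metis in_set_conv_nth)
  thus ?thesis using len by (auto simp: words_def)
qed

lemma sum_standard_blocks_words:
  "(\<Sum>bs\<in>standard_blocks (length ys) n. G (concat bs) * block_weight ys bs) =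
   (\<Sum>u\<in>words (length ys) n. G (concat (fibers (length ys) u)) * word_weight ys u)"
  by (rule sym, rule sum.reindex_bij_witness[where j = "fibers (length ys)" and i = "block_word n"])
     (erule block_word_fibers fibers_in_standard_blocks fibers_block_word block_word_in_words
      | simp only: block_weight_fibers)+

section \<open>Ascents read off the word of the inverse permutation\<close>

definition precedes :: "'a list \<Rightarrow> 'a \<Rightarrow> 'a \<Rightarrow> bool" where
  "precedes v x y \<longleftrightarrow> (\<exists>p q. p < q \<and> q < length v \<and> v ! p = x \<and> v ! q = y)"

text \<open>Equal letters are listed by position, so a tie counts as an ascent of the
  standardization.\<close>

lemma precedes_concat_fibers:
  assumes "u \<in> words l n" "1 \<le> i" "i < n"
  shows "precedes (concat (fibers l u)) i (Suc i) \<longleftrightarrow> u ! (i - 1) \<le> u ! i"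
proof -
  let ?v = "concat (fibers l u)"
  let ?K = "\<lambda>i j. u ! (i - 1) < u ! (j - 1) \<or> u ! (i - 1) = u ! (j - 1) \<and> i < j"
  have K: "?K (?v ! p) (?v ! q)" if "p < q" "q < length ?v" for p q
    by (rule sorted_wrt_nth_less[OF sorted_wrt_concat_fibers that])
  have "i \<in> set ?v" "Suc i \<in> set ?v"
    unfolding set_concat_fibers[OF assms(1)] using assms by auto
  then obtain p q where pq: "p < length ?v" "?v ! p = i" "q < length ?v" "?v ! q = Suc i"
    by (metis in_set_conv_nth)
  show ?thesis
  proof
    assume "precedes ?v i (Suc i)"
    then obtain p q where "p < q" "q < length ?v" "?v ! p = i" "?v ! q = Suc i"
      unfolding precedes_def by blast
    thus "u ! (i - 1) \<le> u ! i" using K[of p q] by auto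
  next
    assume le: "u ! (i - 1) \<le> u ! i"
    have "\<not> q < p" using K[of q p] pq le by auto
    moreover have "p \<noteq> q" using pq by auto
    ultimately have "p < q" by simp
    thus "precedes ?v i (Suc i)" unfolding precedes_def using pq by blast
  qed
qed

text \<open>Connects the recursive pattern, suited to stripping letters, with the positional
  patterns of permutations.\<close>

lemma zigzag_iff_nth:
  "zigzag R u \<longleftrightarrow> (\<forall>i. 1 \<le> i \<and> i < length u \<longrightarrow> (R (u ! (i - 1)) (u ! i) \<longleftrightarrow> odd i))"
proof (induction R u rule: zigzag.induct)
  case (1 R a b c xs)
  have "(\<forall>i. 1 \<le> i \<and> i < length (a # b # c # xs) \<longrightarrow>
          (R ((a # b # c # xs) ! (i - 1)) ((a # b # c # xs) ! i) \<longleftrightarrow> odd i)) \<longleftrightarrow>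
        R a b \<and> \<not> R b c \<and> (\<forall>i. 1 \<le> i \<and> i < length (c # xs) \<longrightarrow>
          (R ((c # xs) ! (i - 1)) ((c # xs) ! i) \<longleftrightarrow> odd i))" (is "?l \<longleftrightarrow> ?r")
  proof
    assume l: ?l
    have "R ((c # xs) ! (i - 1)) ((c # xs) ! i) \<longleftrightarrow> odd i" if "1 \<le> i" "i < length (c # xs)" for i
      using l[rule_format, of "Suc (Suc i)"] that by (cases i) auto
    thus ?r using l[rule_format, of 1] l[rule_format, of 2] by auto
  next
    assume r: ?r
    show ?l
    proof (intro allI impI)
      fix i assume i: "1 \<le> i \<and> i < length (a # b # c # xs)"
      have "i = 1 \<or> i = 2 \<or> i = Suc (Suc (i - 2)) \<and> 1 \<le> i - 2" using i by linarith
      then consider "i = 1" | "i = 2" | k where "i = Suc (Suc k)" "1 \<le> k" by blast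
      thus "R ((a # b # c # xs) ! (i - 1)) ((a # b # c # xs) ! i) \<longleftrightarrow> odd i"
      proof cases
        case (3 k)
        hence "R ((c # xs) ! (k - 1)) ((c # xs) ! k) \<longleftrightarrow> odd k" using r i by auto
        thus ?thesis using 3 by (cases k) auto
      qed (use r in auto)
    qed
  qed
  thus ?case using 1 by simp
next
  case (2 R a b)
  show ?case by (auto simp: less_Suc_eq)
qed auto

text \<open>The one-line word of the inverse of \<open>w\<close>.\<close>

definition positions :: "nat \<Rightarrow> (nat \<Rightarrow> nat) \<Rightarrow> nat list" where
  "positions n w = map (inv w) [1..<Suc n]"

lemma precedes_positions:
  assumes "w permutes {1..n}" "i \<in> {1..n}" "j \<in> {1..n}"
  shows "precedes (positions n w) i j \<longleftrightarrow> w i < w j"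
proof
  assume "precedes (positions n w) i j"
  then obtain p q where pq: "p < q" "q < n" "inv w (Suc p) = i" "inv w (Suc q) = j"
    by (auto simp: precedes_def positions_def simp del: upt_Suc)
  hence "w i = Suc p" "w j = Suc q" using permutes_inverses(1)[OF assms(1)] by auto
  thus "w i < w j" using pq by simp
next
  assume lt: "w i < w j"
  have "w i \<in> {1..n}" "w j \<in> {1..n}" using assms by (simp_all only: permutes_in_image)
  hence "w i - 1 < w j - 1" "w j - 1 < n" "Suc (w i - 1) = w i" "Suc (w j - 1) = w j"
    using lt by auto
  thus "precedes (positions n w) i j"
    unfolding precedes_def using permutes_inverses(2)[OF assms(1)]
    by (intro exI[of _ "w i - 1"] exI[of _ "w j - 1"]) (simp add: positions_def del: upt_Suc)
qed

text \<open>The map \<open>positions n\<close> is injective into a set of the same cardinality,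
  hence bijective.\<close>

lemma sum_permutes_eq_sum_positions:
  "(\<Sum>w | w permutes {1..n}. F (positions n w)) = (\<Sum>v\<in>permutations_of_set {1..n}. F v)"
proof (rule sum.reindex_bij_betw)
  have inj: "inj_on (positions n) {w. w permutes {1..n}}"
  proof (rule inj_onI, unfold mem_Collect_eq)
    fix w w' assume w: "w permutes {1..n}" "w' permutes {1..n}" and eq: "positions n w = positions n w'"
    have "inv w i = inv w' i" for i
    proof (cases "i \<in> {1..n}")
      case True
      have "positions n w ! (i - 1) = positions n w' ! (i - 1)" using eq by simp
      moreover have "i - 1 < n" "Suc (i - 1) = i" using True by auto
      ultimately show ?thesis by (simp add: positions_def del: upt_Suc)
    next
      case False
      thus ?thesis using w by (metis permutes_inv permutes_not_in)
    qed
    thus "w = w'" using w by (metis ext permutes_inv_inv)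
  qed
  have "positions n w \<in> permutations_of_set {1..n}" if "w permutes {1..n}" for w
  proof -
    have "inj (inv w)" "inv w ` {1..n} = {1..n}"
      using permutes_inv[OF that] by (auto simp: permutes_inj permutes_image)
    moreover have "set [1..<Suc n] = {1..n}" by auto
    ultimately show ?thesis
      by (auto simp: positions_def permutations_of_set_def distinct_map inj_on_def simp del: upt_Suc set_upt)
  qed
  hence sub: "positions n ` {w. w permutes {1..n}} \<subseteq> permutations_of_set {1..n}" by auto
  have "card (positions n ` {w. w permutes {1..n}}) = card (permutations_of_set {1..n})"
    unfolding card_image[OF inj]
    by (subst card_permutations[OF refl]) (simp_all add: card_permutations_of_set)
  hence "positions n ` {w. w permutes {1..n}} = permutations_of_set {1..n}"
    by (rule card_subset_eq[OF finite_permutations_of_set sub])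
  thus "bij_betw (positions n) {w. w permutes {1..n}} (permutations_of_set {1..n})"
    using inj by (simp add: bij_betw_def)
qed

definition ascent_pattern :: "bool \<Rightarrow> nat \<Rightarrow> (nat \<Rightarrow> nat) \<Rightarrow> bool" where
  "ascent_pattern s n w \<longleftrightarrow> (\<forall>i. 1 \<le> i \<and> i < n \<longrightarrow> (w i < w (Suc i) \<longleftrightarrow> odd i = s))"

text \<open>Standardization makes equal neighbours an ascent, so the condition on words is weak for
  ascents and strict for descents.\<close>

definition ascent_rel :: "bool \<Rightarrow> nat \<Rightarrow> nat \<Rightarrow> bool" where
  "ascent_rel s = (if s then (\<le>) else (>))"

lemma standardization:
  "(\<Sum>w | w permutes {1..n}. of_bool (ascent_pattern s n w) *
       foldr (chain_op (<)) ys nil_ind (positions n w)) =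
   (\<Sum>u\<in>words (length ys) n. of_bool (zigzag (ascent_rel s) u) * word_weight ys u)"
proof -
  \<comment> \<open>\<open>G\<close> expresses the ascent pattern of \<open>w\<close> through the
    word of its inverse, the form that can be carried from permutations to blocks and on to
    words.\<close>
  define G :: "nat list \<Rightarrow> real" where
    "G v = of_bool (\<forall>i. 1 \<le> i \<and> i < n \<longrightarrow> (precedes v i (Suc i) \<longleftrightarrow> odd i = s))" for v
  have "(\<Sum>w | w permutes {1..n}. of_bool (ascent_pattern s n w) *
          foldr (chain_op (<)) ys nil_ind (positions n w)) =
        (\<Sum>w | w permutes {1..n}. G (positions n w) * foldr (chain_op (<)) ys nil_ind (positions n w))"
  proof (rule sum.cong)
    fix w assume "w \<in> {w. w permutes {1..n}}"
    hence "ascent_pattern s n w \<longleftrightarrow>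
        (\<forall>i. 1 \<le> i \<and> i < n \<longrightarrow> (precedes (positions n w) i (Suc i) \<longleftrightarrow> odd i = s))"
      by (auto simp: ascent_pattern_def precedes_positions)
    thus "of_bool (ascent_pattern s n w) * foldr (chain_op (<)) ys nil_ind (positions n w) =
        G (positions n w) * foldr (chain_op (<)) ys nil_ind (positions n w)"
      by (simp add: G_def)
  qed simp
  also have "\<dots> = (\<Sum>u\<in>words (length ys) n. G (concat (fibers (length ys) u)) * word_weight ys u)"
    unfolding sum_permutes_eq_sum_positions[of "\<lambda>v. G v * foldr (chain_op (<)) ys nil_ind v"]
      sum_permutations_blocks sum_standard_blocks_words ..
  also have "\<dots> = (\<Sum>u\<in>words (length ys) n. of_bool (zigzag (ascent_rel s) u) * word_weight ys u)"
  proof (rule sum.cong)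
    fix u assume u: "u \<in> words (length ys) n"
    hence "length u = n" by (simp add: words_def)
    hence "zigzag (ascent_rel s) u \<longleftrightarrow>
      (\<forall>i. 1 \<le> i \<and> i < n \<longrightarrow> (precedes (concat (fibers (length ys) u)) i (Suc i) \<longleftrightarrow> odd i = s))"
      unfolding zigzag_iff_nth using precedes_concat_fibers[OF u]
      by (cases s) (auto simp: ascent_rel_def not_le[symmetric])
    thus "G (concat (fibers (length ys) u)) * word_weight ys u =
        of_bool (zigzag (ascent_rel s) u) * word_weight ys u"
      by (simp add: G_def)
  qed simp
  finally show ?thesis .
qed

section \<open>Words with sign weights\<close>

abbreviation (input) root_series :: "real fps" where
  "root_series \<equiv> fps_radical root 2 (1 - fps_X\<^sup>2)"

text \<open>As a power this is ((1 + t) / (1 - t)) to the exponent b/2.\<close>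

abbreviation exp_L :: "real \<Rightarrow> real fps" where
  "exp_L b \<equiv> fps_exp b oo L_series"

definition fps_cosh :: "real \<Rightarrow> real fps" where
  "fps_cosh b = fps_const (1/2) * (fps_exp b + fps_exp (-b))"

definition fps_sinh :: "real \<Rightarrow> real fps" where
  "fps_sinh b = fps_const (1/2) * (fps_exp b - fps_exp (-b))"

lemma L_series_nth_0 [simp]: "L_series $ 0 = 0"
  by (simp add: L_series_nth)

lemma exp_L_add: "exp_L (a + b) = exp_L a * exp_L b"
  by (simp add: fps_exp_add_mult fps_compose_mult_distrib)

lemma deriv_L_series: "fps_deriv L_series * (1 - fps_X\<^sup>2) = 1"
proof -
  have d: "fps_deriv L_series = Abs_fps (\<lambda>n. if even n then 1 else 0)"
    by (simp add: fps_eq_iff L_series_nth del: of_nat_Suc)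
  show ?thesis
    unfolding d by (auto simp: right_diff_distrib fps_eq_iff fps_X_power_mult_right_nth less_2_cases_iff)
qed

lemma root_series_nth_0: "root_series $ 0 = 1"
  by (rule fps_radical_one_minus_X_square)

lemma root_series_nonzero: "root_series \<noteq> 0"
  by (metis root_series_nth_0 fps_zero_nth zero_neq_one)

text \<open>Both sides satisfy \<open>(1 - t\<^sup>2) y' = - t y\<close>.\<close>

lemma exp_L_1: "exp_L 1 * (1 - fps_X) = root_series"
proof -
  define U where "U = root_series"
  define V where "V = exp_L 1 * (1 - fps_X)"
  define q :: "real fps" where "q = 1 - fps_X\<^sup>2"
  have UU: "U * U = q" and U0: "U $ 0 = 1"
    using fps_radical_one_minus_X_square by (simp_all add: U_def q_def power2_eq_square)
  have inv: "U * inverse U = 1" using U0 by (simp add: inverse_mult_eq_1')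
  have dV: "fps_deriv V * q = - fps_X * V"
  proof -
    have "fps_deriv V * q = exp_L 1 * (1 - fps_X) * (fps_deriv L_series * q) - exp_L 1 * q"
      by (simp add: V_def fps_compose_deriv algebra_simps)
    also have "\<dots> = - fps_X * V"
      unfolding q_def deriv_L_series by (simp add: V_def algebra_simps power2_eq_square)
    finally show ?thesis .
  qed
  have dU: "U * fps_deriv U = - fps_X"
  proof -
    have "fps_deriv (U * U) = fps_deriv (1 - fps_X\<^sup>2)" unfolding UU q_def ..
    hence "2 * (U * fps_deriv U) = 2 * (- fps_X)"
      by (simp add: power2_eq_square algebra_simps)
    thus ?thesis by (simp only: mult_cancel_left) simp
  qed
  \<comment> \<open>The quotient rule for \<open>V\<close> over \<open>U\<close>, multiplied by the
    square of \<open>U\<close>; here \<open>j\<close> stands for the inverse of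
    \<open>U\<close>.\<close>
  have ring: "(v * (- u' * j\<^sup>2) + v' * j) * (u * u) = v' * (u * u) * j - v * (u * u') * j * (u * j)"
    for v v' u u' j :: "real fps"
    by (simp add: algebra_simps power2_eq_square)
  have "fps_deriv (V * inverse U) * q =
      fps_deriv V * q * inverse U - V * (U * fps_deriv U) * inverse U * (U * inverse U)"
    using U0 by (simp only: fps_deriv_mult fps_inverse_deriv UU[symmetric] ring)
  also have "\<dots> = 0" unfolding dU dV inv by simp
  finally have "fps_deriv (V * inverse U) * q = 0" .
  moreover have "q \<noteq> 0" using deriv_L_series by (auto simp: q_def)
  ultimately have "fps_deriv (V * inverse U) = fps_deriv 1"
    by simp
  hence "V * inverse U = 1"
    using U0 by (subst (asm) fps_deriv_eq_iff) (simp add: fps_mult_nth_0 V_def)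
  hence "V * (U * inverse U) = U" by (simp add: mult.left_commute)
  thus ?thesis unfolding inv by (simp add: U_def V_def)
qed

text \<open>For \<open>y = -1\<close>, the product of both cases is (1 - t)(1 + t), the square of
  \<open>root_series\<close>, and one factor is cancelled.\<close>

lemma exp_L_sign:
  assumes "y \<in> {1, -1}"
  shows "exp_L y * (1 - fps_const y * fps_X) = root_series"
proof (cases "y = 1")
  case False
  hence y: "y = -1" using assms by simp
  have "exp_L 1 * exp_L (-1) = 1" by (simp flip: exp_L_add)
  hence "root_series * (exp_L (-1) * (1 + fps_X)) = (1 - fps_X) * (1 + fps_X)"
    unfolding exp_L_1[symmetric] by (simp add: mult.assoc mult.left_commute)
  also have "\<dots> = root_series\<^sup>2"
    unfolding fps_radical_one_minus_X_square by (simp add: algebra_simps power2_eq_square)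
  finally have "exp_L (-1) * (1 + fps_X) = root_series"
    using root_series_nonzero by (simp add: power2_eq_square)
  moreover have "fps_const (-1) = (-1 :: real fps)" by (simp flip: fps_const_neg)
  ultimately show ?thesis using y by simp
qed (use exp_L_1 in simp)

definition ascent_scale :: "bool \<Rightarrow> real fps" where
  "ascent_scale s = (if s then root_series else inverse root_series)"

lemma ascent_scale_nth_0 [simp]: "ascent_scale s $ 0 = 1"
  using fps_radical_one_minus_X_square(2) by (simp add: ascent_scale_def)

text \<open>By \<open>exp_L_sign\<close>, a letter of weight z = 1 or z = -1 contributes 1/(1 - c z
  t) = exp(c z L) / \<open>root_series\<close> for weak ascents and 1 + c z t = exp(c z L)
  \<open>root_series\<close> for descents. After rescaling, only the sum of the weights
  matters.\<close>

lemma word_gf_chain_sign: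
  assumes "set ys \<subseteq> {1, -1}" "c \<in> {1, -1}"
  shows "ascent_scale s ^ length ys * word_gf ys (chain_op (ascent_rel s) c nil_ind) =
         exp_L (c * sum_list ys)"
  using assms(1)
proof (induction ys rule: rev_induct)
  case Nil
  show ?case by (simp add: word_gf_Nil_chain)
next
  case (snoc z ys)
  define H where "H = (\<lambda>ys. word_gf ys (chain_op (ascent_rel s) c nil_ind))"
  let ?X = "ascent_scale s"
  have IH: "?X ^ length ys * H ys = exp_L (c * sum_list ys)"
    using snoc unfolding H_def by simp
  have cz: "c * z \<in> {1, -1}" "- (c * z) \<in> {1, -1}" using snoc.prems assms(2) by auto
  have step: "?X * H (ys @ [z]) = exp_L (c * z) * H ys"
  proof (cases s)
    case True
    have "?X * H (ys @ [z]) = exp_L (c * z) * (H (ys @ [z]) * (1 - fps_const (c * z) * fps_X))"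
      using True exp_L_sign[OF cz(1)] by (simp add: ascent_scale_def mult_ac)
    also have "\<dots> = exp_L (c * z) * H ys"
      using word_gf_chain_le_snoc[of ys z c] True by (simp add: H_def ascent_rel_def)
    finally show ?thesis .
  next
    case False
    have U0: "root_series $ 0 \<noteq> 0" unfolding root_series_nth_0 by simp
    have neg: "fps_const (- (c * z)) = - fps_const (c * z)" by simp
    have "exp_L (c * z) * exp_L (- (c * z)) = 1" by (simp flip: exp_L_add)
    hence "1 + fps_const (c * z) * fps_X =
        exp_L (c * z) * (exp_L (- (c * z)) * (1 - fps_const (- (c * z)) * fps_X))"
      unfolding neg by (simp flip: mult.assoc del: fps_const_neg fps_const_mult)
    also have "\<dots> = exp_L (c * z) * root_series" unfolding exp_L_sign[OF cz(2)] ..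
    finally have "?X * H (ys @ [z]) = exp_L (c * z) * H ys * (inverse root_series * root_series)"
      using False word_gf_chain_gt_snoc[of ys z c]
      by (simp add: H_def ascent_rel_def ascent_scale_def mult_ac)
    thus ?thesis using U0 by (simp add: inverse_mult_eq_1)
  qed
  have "?X ^ length (ys @ [z]) * H (ys @ [z]) = ?X ^ length ys * (?X * H (ys @ [z]))"
    by (simp add: mult_ac)
  also have "\<dots> = exp_L (c * z) * (?X ^ length ys * H ys)"
    unfolding step by (simp add: mult_ac)
  also have "\<dots> = exp_L (c * sum_list (ys @ [z]))"
    unfolding IH exp_L_add[symmetric] by (simp add: algebra_simps)
  finally show ?case unfolding H_def .
qed

section \<open>Hyperbolic series of zigzag words\<close>

definition fps_sech :: "real fps" where "fps_sech = inverse (fps_cosh 1)"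
definition fps_tanh :: "real fps" where "fps_tanh = fps_sinh 1 * fps_sech"

lemma fps_cosh_nth: "fps_cosh b $ n = (if even n then b ^ n / fact n else 0)"
  by (auto simp: fps_cosh_def fps_exp_def)

lemma fps_sinh_nth: "fps_sinh b $ n = (if odd n then b ^ n / fact n else 0)"
  by (auto simp: fps_sinh_def fps_exp_def)

lemma fps_cosh_sech: "fps_cosh 1 * fps_sech = 1"
  unfolding fps_sech_def by (rule inverse_mult_eq_1') (simp add: fps_cosh_nth)

lemma fps_cosh_tanh: "fps_cosh 1 * fps_tanh = fps_sinh 1"
  using fps_cosh_sech by (simp add: fps_tanh_def mult.left_commute)

lemma compose_L_cancel:
  assumes "f * fps_cosh 1 = g"
  shows "((f oo fps_const b * fps_X) oo L_series) * (fps_cosh b oo L_series) =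
         (g oo fps_const b * fps_X) oo L_series"
proof -
  have "fps_cosh b = fps_cosh 1 oo fps_const b * fps_X"
    by (simp add: fps_eq_iff fps_compose_linear fps_cosh_nth)
  thus ?thesis
    by (simp add: assms flip: fps_compose_mult_distrib)
qed

lemma cosh_L_nonzero: "fps_cosh b oo L_series \<noteq> 0"
proof
  assume "fps_cosh b oo L_series = 0"
  hence "(fps_cosh b oo L_series) $ 0 = 0" by simp
  thus False by (simp add: fps_cosh_nth)
qed

text \<open>On word series, \<open>even_op_zigzag_sign\<close> says that the zigzag series times
  cosh(b L) is the rescaled base series. The latter is the scale factor itself for even length and
  sinh(b L) for odd length, where the scale is absorbed.\<close>

lemma word_gf_zigzag_sign:
  assumes "set ys \<subseteq> {1, -1}"
  defines "b \<equiv> sum_list ys"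
  shows "word_gf ys (zigzag_sign (ascent_rel s) True) =
           ascent_scale s ^ length ys * ((fps_sech oo fps_const b * fps_X) oo L_series)"
    and "word_gf ys (zigzag_sign (ascent_rel s) False) =
           (fps_tanh oo fps_const b * fps_X) oo L_series"
proof -
  let ?R = "ascent_rel s" and ?X = "ascent_scale s ^ length ys"
  let ?H = "\<lambda>c. word_gf ys (chain_op ?R c nil_ind)"
  have H: "?X * ?H 1 = exp_L b" "?X * ?H (-1) = exp_L (-b)"
    using word_gf_chain_sign[OF assms(1), of _ s] by (simp_all add: b_def)
  have c: "fps_cosh b oo L_series = ?X * (fps_const (1/2) * (?H 1 + ?H (-1)))"
    by (simp add: fps_cosh_def fps_compose_mult_distrib fps_compose_add_distrib algebra_simps
          flip: H)
  have sh: "fps_sinh b oo L_series = ?X * (fps_const (1/2) * (?H 1 - ?H (-1)))"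
    by (simp add: fps_sinh_def fps_compose_mult_distrib fps_compose_sub_distrib algebra_simps
          flip: H)
  have main: "(fps_cosh b oo L_series) * word_gf ys (zigzag_sign ?R p) = ?X * word_gf ys (zigzag_base ?R p)" for p
  proof -
    have "even_op ?R (zigzag_sign ?R p) = zigzag_base ?R p"
      by (rule ext) (rule even_op_zigzag_sign)
    thus ?thesis unfolding c using word_gf_even_op[of ys ?R "zigzag_sign ?R p"]
      by (simp add: mult.assoc)
  qed
  have "zigzag_base ?R True = nil_ind" by (auto simp: zigzag_base_def)
  hence "(fps_cosh b oo L_series) * word_gf ys (zigzag_sign ?R True) = ?X * 1"
    unfolding main by (simp add: word_gf_nil_ind)
  also have "1 = ((fps_sech oo fps_const b * fps_X) oo L_series) * (fps_cosh b oo L_series)"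
    by (subst compose_L_cancel[where g = 1]) (use fps_cosh_sech in \<open>simp_all add: mult.commute\<close>)
  finally have "(fps_cosh b oo L_series) * word_gf ys (zigzag_sign ?R True) =
      (fps_cosh b oo L_series) * (?X * ((fps_sech oo fps_const b * fps_X) oo L_series))"
    by (simp only: mult_ac)
  thus "word_gf ys (zigzag_sign ?R True) = ?X * ((fps_sech oo fps_const b * fps_X) oo L_series)"
    using cosh_L_nonzero by (simp only: mult_cancel_left) simp
  have "word_gf ys (zigzag_base ?R False) = fps_const (1/2) * (?H 1 - ?H (-1))"
    unfolding zigzag_base_odd[abs_def] word_gf_lincomb ..
  hence "(fps_cosh b oo L_series) * word_gf ys (zigzag_sign ?R False) = fps_sinh b oo L_series"
    unfolding main sh by simp
  also have "fps_sinh b = fps_sinh 1 oo fps_const b * fps_X"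
    by (simp add: fps_eq_iff fps_compose_linear fps_sinh_nth)
  also have "\<dots> oo L_series = ((fps_tanh oo fps_const b * fps_X) oo L_series) * (fps_cosh b oo L_series)"
    by (subst compose_L_cancel[where g = "fps_sinh 1"]) (use fps_cosh_tanh in \<open>simp_all add: mult.commute\<close>)
  finally have "(fps_cosh b oo L_series) * word_gf ys (zigzag_sign ?R False) =
      (fps_cosh b oo L_series) * ((fps_tanh oo fps_const b * fps_X) oo L_series)"
    by (simp only: mult_ac)
  thus "word_gf ys (zigzag_sign ?R False) = (fps_tanh oo fps_const b * fps_X) oo L_series"
    using cosh_L_nonzero by (simp only: mult_cancel_left) simp
qed

section \<open>Inversion of the averaging operator\<close>

lemma chain_op_lincomb:
  "chain_op R y (\<lambda>v. \<alpha> * \<Phi> v + \<beta> * \<Psi> v) v = \<alpha> * chain_op R y \<Phi> v + \<beta> * chain_op R y \<Psi> v"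
  unfolding chain_op_def sum_distrib_left sum.distrib[symmetric]
  by (rule sum.cong) (auto simp: algebra_simps)

lemma foldr_chain_op_lincomb:
  "foldr (chain_op R) ys (\<lambda>v. \<alpha> * \<Phi> v + \<beta> * \<Psi> v) v =
     \<alpha> * foldr (chain_op R) ys \<Phi> v + \<beta> * foldr (chain_op R) ys \<Psi> v"
proof (induction ys arbitrary: v)
  case (Cons y ys)
  have "foldr (chain_op R) ys (\<lambda>v. \<alpha> * \<Phi> v + \<beta> * \<Psi> v) =
      (\<lambda>v. \<alpha> * foldr (chain_op R) ys \<Phi> v + \<beta> * foldr (chain_op R) ys \<Psi> v)"
    using Cons by blast
  thus ?case by (simp add: chain_op_lincomb)
qed simp

lemma foldr_chain_op_half_diff:
  "foldr (chain_op R) ys (\<lambda>v. (\<Phi> v - \<Psi> v) / 2) v =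
     (foldr (chain_op R) ys \<Phi> v - foldr (chain_op R) ys \<Psi> v) / 2"
  using foldr_chain_op_lincomb[of R ys "1/2" \<Phi> "-1/2" \<Psi> v] by (simp add: diff_divide_distrib)

text \<open>An operator applied innermost is the same as one more weight at the end of
  \<open>ys\<close>.\<close>

lemma foldr_chain_op_even_defect:
  "foldr (chain_op R) ys (even_defect R \<Phi>) v =
     foldr (chain_op R) ys \<Phi> v -
     (foldr (chain_op R) (ys @ [1]) \<Phi> v + foldr (chain_op R) (ys @ [-1]) \<Phi> v) / 2"
proof -
  have e: "even_defect R \<Phi> = (\<lambda>v. 1 * \<Phi> v + (-1/2) * (1 * chain_op R 1 \<Phi> v + 1 * chain_op R (-1) \<Phi> v))"
    by (simp add: fun_eq_iff even_op_def)
  show ?thesis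
    unfolding e foldr_chain_op_lincomb by simp
qed

text \<open>Counterpart of \<open>even_op\<close> on series: one more letter of weight 1 or -1
  shifts the sum \<open>b\<close> and brings a factor \<open>X\<close>.\<close>

definition shift_mean :: "real fps \<Rightarrow> (real \<Rightarrow> real fps) \<Rightarrow> real \<Rightarrow> real fps" where
  "shift_mean X \<Psi> b = X * (fps_const (1/2) * (\<Psi> (b + 1) + \<Psi> (b - 1)))"

abbreviation shift_defect :: "real fps \<Rightarrow> (real \<Rightarrow> real fps) \<Rightarrow> real \<Rightarrow> real fps" where
  "shift_defect X \<Psi> \<equiv> (\<lambda>b. \<Psi> b - shift_mean X \<Psi> b)"

text \<open>Each defect appends a sign to \<open>ys\<close>, so the induction on \<open>r\<close>
  must range over all sign lists.\<close>

lemma transfer_defect: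
  fixes c :: "'w \<Rightarrow> real" and v :: "'w \<Rightarrow> 'a list"
  assumes "\<And>ys. set ys \<subseteq> {1, -1} \<Longrightarrow>
      (\<Sum>w\<in>A. c w * foldr (chain_op R) ys B (v w)) = (X ^ length ys * \<Psi> (sum_list ys)) $ n"
    and "set ys \<subseteq> {1, -1}"
  shows "(\<Sum>w\<in>A. c w * foldr (chain_op R) ys ((even_defect R ^^ r) B) (v w)) =
         (X ^ length ys * (shift_defect X ^^ r) \<Psi> (sum_list ys)) $ n"
  using assms(2)
proof (induction r arbitrary: ys)
  case 0
  thus ?case using assms(1) by simp
next
  case (Suc r)
  define \<Phi> where "\<Phi> = (shift_defect X ^^ r) \<Psi>"
  define C where "C = (even_defect R ^^ r) B"
  define S where "S ys = (\<Sum>w\<in>A. c w * foldr (chain_op R) ys C (v w))" for ys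
  have IH: "S ys = (X ^ length ys * \<Phi> (sum_list ys)) $ n" if "set ys \<subseteq> {1, -1}" for ys
    using Suc.IH[OF that] by (simp add: S_def \<Phi>_def C_def)
  have "(\<Sum>w\<in>A. c w * foldr (chain_op R) ys (even_defect R C) (v w)) =
      S ys - (S (ys @ [1]) + S (ys @ [-1])) / 2"
    unfolding foldr_chain_op_even_defect S_def
    by (simp add: right_diff_distrib sum_subtractf distrib_left sum.distrib add_divide_distrib
        sum_divide_distrib)
  also have "\<dots> = (X ^ length ys * \<Phi> (sum_list ys) - fps_const (1/2) *
      (X ^ Suc (length ys) * \<Phi> (sum_list ys + 1) + X ^ Suc (length ys) * \<Phi> (sum_list ys - 1))) $ n"
    using Suc.prems by (simp add: IH)
  also have "\<dots> = (X ^ length ys * shift_defect X \<Phi> (sum_list ys)) $ n"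
    by (rule arg_cong[where f = "\<lambda>f. f $ n"]) (simp add: shift_mean_def algebra_simps)
  finally show ?case by (simp add: C_def \<Phi>_def)
qed

section \<open>Iterated central differences in \<open>b\<close>\<close>

definition cdiff :: "(real \<Rightarrow> real) \<Rightarrow> real \<Rightarrow> real" where
  "cdiff f b = f b - (f (b + 1) + f (b - 1)) / 2"

text \<open>A substitute for a degree bound in \<open>b\<close>: \<open>cdiff\<close> lowers the
  degree of a polynomial, so low degree makes an iterate vanish.\<close>

definition cdiff_null :: "nat \<Rightarrow> (real \<Rightarrow> real) \<Rightarrow> bool" where
  "cdiff_null d f \<longleftrightarrow> (\<forall>b. (cdiff ^^ d) f b = 0)"

lemma cdiff_funpow_zero: "(cdiff ^^ d) (\<lambda>_. 0) = (\<lambda>_. 0)"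
  by (induction d) (auto simp: cdiff_def)

lemma cdiff_funpow_lincomb:
  "(cdiff ^^ d) (\<lambda>b. \<alpha> * f b + \<beta> * g b) = (\<lambda>b. \<alpha> * (cdiff ^^ d) f b + \<beta> * (cdiff ^^ d) g b)"
proof (induction d)
  case (Suc d)
  have "cdiff (\<lambda>b. \<alpha> * F b + \<beta> * H b) = (\<lambda>b. \<alpha> * cdiff F b + \<beta> * cdiff H b)" for F H
    by (simp add: fun_eq_iff cdiff_def field_simps)
  thus ?case by (simp add: Suc)
qed simp

lemma cdiff_null_lincomb:
  "cdiff_null d f \<Longrightarrow> cdiff_null d g \<Longrightarrow> cdiff_null d (\<lambda>b. \<alpha> * f b + \<beta> * g b)"
  by (simp add: cdiff_null_def cdiff_funpow_lincomb)

lemma cdiff_null_zero: "cdiff_null d (\<lambda>_. 0)"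
  by (simp add: cdiff_null_def cdiff_funpow_zero)

lemma cdiff_null_cmult: "cdiff_null d f \<Longrightarrow> cdiff_null d (\<lambda>b. \<alpha> * f b)"
  using cdiff_null_lincomb[of d f f \<alpha> 0] by simp

lemma cdiff_null_diff: "cdiff_null d f \<Longrightarrow> cdiff_null d g \<Longrightarrow> cdiff_null d (\<lambda>b. f b - g b)"
  using cdiff_null_lincomb[of d f g 1 "-1"] by simp

lemma cdiff_null_sum:
  assumes "\<And>i. i \<in> I \<Longrightarrow> cdiff_null d (f i)"
  shows "cdiff_null d (\<lambda>b. \<Sum>i\<in>I. f i b)"
  using assms
proof (induction I rule: infinite_finite_induct)
  case (insert i I)
  thus ?case using cdiff_null_lincomb[of d "f i" "\<lambda>b. \<Sum>i\<in>I. f i b" 1 1] by simp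
qed (simp_all add: cdiff_null_zero)

lemma cdiff_null_Suc: "cdiff_null (Suc d) f \<longleftrightarrow> cdiff_null d (cdiff f)"
  by (simp add: cdiff_null_def funpow_swap1)


lemma cdiff_null_mono:
  assumes "cdiff_null d f" "d \<le> e"
  shows "cdiff_null e f"
proof -
  have "(cdiff ^^ (e - d + d)) f = (cdiff ^^ (e - d)) (\<lambda>_. 0)"
    unfolding funpow_add o_def using assms(1)
    by (intro arg_cong[where f = "cdiff ^^ (e - d)"]) (simp add: cdiff_null_def fun_eq_iff)
  thus ?thesis using assms(2) by (simp add: cdiff_null_def cdiff_funpow_zero)
qed

lemma cdiff_null_cdiff: "cdiff_null d f \<Longrightarrow> cdiff_null d (cdiff f)"
  using cdiff_null_mono[of d f "Suc d"] by (simp add: cdiff_null_Suc)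

lemma fps_exp_shift:
  "fps_exp (b + 1 :: real) = fps_exp b * fps_exp 1" "fps_exp (b - 1 :: real) = fps_exp b * fps_exp (-1)"
  using fps_exp_add_mult[of b 1] fps_exp_add_mult[of b "-1"] by simp_all

lemma shift_mean_exp:
  "fps_const (1/2) * (fps_exp (b + 1) * G + fps_exp (b - 1) * G) = fps_exp b * (G * fps_cosh 1)"
  unfolding fps_exp_shift fps_cosh_def by (simp add: algebra_simps)

text \<open>Averaging the shifts of \<open>b\<close> by 1 and -1 multiplies exp(b x) by cosh x, so
  each \<open>cdiff\<close> multiplies by 1 - cosh x.\<close>

lemma cdiff_funpow_exp:
  "(cdiff ^^ d) (\<lambda>b. (fps_exp b * G) $ m) = (\<lambda>b. (fps_exp b * (G * (1 - fps_cosh 1) ^ d)) $ m)"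
proof (induction d)
  case (Suc d)
  define K where "K = G * (1 - fps_cosh 1) ^ d"
  have "cdiff (\<lambda>b. (fps_exp b * K) $ m) b = (fps_exp b * (K * (1 - fps_cosh 1))) $ m" for b
  proof -
    have "cdiff (\<lambda>b. (fps_exp b * K) $ m) b =
        (fps_exp b * K - fps_const (1/2) * (fps_exp (b + 1) * K + fps_exp (b - 1) * K)) $ m"
      by (simp add: cdiff_def)
    thus ?thesis unfolding shift_mean_exp by (simp add: algebra_simps)
  qed
  thus ?case by (simp add: Suc K_def[symmetric]) (simp add: K_def mult_ac)
qed simp

text \<open>The series 1 - cosh x has no constant term, so its power \<open>Suc m\<close> has no
  coefficient up to degree \<open>m\<close>.\<close>

lemma cdiff_null_exp: "cdiff_null (Suc m) (\<lambda>b. (fps_exp b * G) $ m)"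
proof -
  have z: "(1 - fps_cosh 1) ^ Suc m $ k = 0" if "k \<le> m" for k
    using startsby_zero_power_prefix[of "1 - fps_cosh 1" "Suc m"] that by (simp add: fps_cosh_nth)
  have "(fps_exp b * (G * (1 - fps_cosh 1) ^ Suc m)) $ m = 0" for b
    unfolding mult.assoc[symmetric] by (subst fps_mult_nth) (intro sum.neutral, use z in auto)
  thus ?thesis unfolding cdiff_null_def cdiff_funpow_exp by blast
qed

text \<open>The coefficient of \<open>t\<^sup>i\<close> behaves like a polynomial in \<open>b\<close> of degree less than \<open>i + 1 - j\<close>.\<close>

definition shift_filtered :: "nat \<Rightarrow> (real \<Rightarrow> real fps) \<Rightarrow> bool" where
  "shift_filtered j \<Psi> \<longleftrightarrow> (\<forall>i. cdiff_null (i + 1 - j) (\<lambda>b. \<Psi> b $ i))"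

text \<open>Because \<open>X\<close> has constant term 1, coefficient \<open>i\<close> of the defect
  is \<open>cdiff\<close> of coefficient \<open>i\<close>, which gains one order, minus multiples of
  means of earlier coefficients, whose order is small enough already.\<close>

lemma shift_filtered_defect:
  assumes X: "X $ 0 = 1" and \<Psi>: "shift_filtered j \<Psi>"
  shows "shift_filtered (Suc j) (shift_defect X \<Psi>)"
  unfolding shift_filtered_def
proof
  fix i
  have null: "cdiff_null (k + 1 - j) (\<lambda>b. \<Psi> b $ k)" for k
    using \<Psi> by (simp add: shift_filtered_def)
  let ?mean = "\<lambda>k b. \<Psi> b $ k - cdiff (\<lambda>b. \<Psi> b $ k) b"
  have eq: "shift_defect X \<Psi> b $ i = cdiff (\<lambda>b. \<Psi> b $ i) b - (\<Sum>a\<in>{1..i}. X $ a * ?mean (i - a) b)" for b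
  proof -
    have "shift_mean X \<Psi> b $ i = (\<Sum>a=0..i. X $ a * ?mean (i - a) b)"
      unfolding shift_mean_def fps_mult_nth[of X] by (rule sum.cong) (simp_all add: cdiff_def)
    also have "\<dots> = ?mean i b + (\<Sum>a\<in>{1..i}. X $ a * ?mean (i - a) b)"
      by (subst sum.atLeast_Suc_atMost) (simp_all add: X)
    finally show ?thesis by simp
  qed
  have "cdiff_null (i - j) (cdiff (\<lambda>b. \<Psi> b $ i))"
  proof (cases "j \<le> i")
    case True
    thus ?thesis using null[of i] by (simp add: Suc_diff_le cdiff_null_Suc)
  next
    \<comment> \<open>Both \<open>i + 1 - j\<close> and \<open>i - j\<close> truncate to 0:
      coefficient \<open>i\<close> is already identically zero.\<close>
    case False
    thus ?thesis using cdiff_null_cdiff[OF null[of i]] by simp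
  qed
  moreover have "cdiff_null (i - j) (\<lambda>b. X $ a * ?mean (i - a) b)" if "a \<in> {1..i}" for a
  proof -
    have "cdiff_null (i - j) (\<lambda>b. \<Psi> b $ (i - a))"
      using that by (intro cdiff_null_mono[OF null[of "i - a"]]) auto
    thus ?thesis by (intro cdiff_null_cmult cdiff_null_diff cdiff_null_cdiff)
  qed
  ultimately show "cdiff_null (i + 1 - Suc j) (\<lambda>b. shift_defect X \<Psi> b $ i)"
    unfolding eq by (auto intro!: cdiff_null_diff cdiff_null_sum)
qed

lemma shift_filtered_funpow:
  "X $ 0 = 1 \<Longrightarrow> shift_filtered 0 \<Psi> \<Longrightarrow> shift_filtered r ((shift_defect X ^^ r) \<Psi>)"
  by (induction r) (simp_all add: shift_filtered_defect)

lemma shift_mean_defect_commute: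
  "shift_mean X ((shift_defect X ^^ r) \<Psi>) = (shift_defect X ^^ r) (shift_mean X \<Psi>)"
proof (induction r)
  case (Suc r)
  define \<Phi> where "\<Phi> = (shift_defect X ^^ r) \<Psi>"
  have "shift_mean X (shift_defect X \<Phi>) = shift_defect X (shift_mean X \<Phi>)"
    by (simp add: fun_eq_iff shift_mean_def algebra_simps)
  thus ?case using Suc by (simp add: \<Phi>_def)
qed simp

text \<open>The same telescoping as in \<open>sum_even_defect_base\<close>, now for
  \<open>shift_mean\<close>; the filtration replaces the bound on word length.\<close>

lemma sum_shift_defect:
  assumes "X $ 0 = 1" "shift_filtered 0 \<Theta>"
  shows "(\<Sum>r\<le>n. (shift_defect X ^^ r) (shift_mean X \<Theta>) b $ n) = \<Theta> b $ n"
proof -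
  let ?D = "\<lambda>r. (shift_defect X ^^ r) \<Theta> b $ n"
  have "(\<Sum>r\<le>n. (shift_defect X ^^ r) (shift_mean X \<Theta>) b $ n) = (\<Sum>r\<le>n. ?D r - ?D (Suc r))"
    unfolding shift_mean_defect_commute[symmetric] by simp
  also have "\<dots> = \<Theta> b $ n - ?D (Suc n)"
    by (subst sum_telescope) simp
  \<comment> \<open>The order \<open>n + 1 - Suc n\<close> is 0, so the remainder has zero
    coefficient at \<open>n\<close> for every \<open>b\<close>.\<close>
  also have "cdiff_null (n + 1 - Suc n) (\<lambda>b. (shift_defect X ^^ Suc n) \<Theta> b $ n)"
    using shift_filtered_funpow[OF assms, of "Suc n"] unfolding shift_filtered_def by (rule spec)
  hence "?D (Suc n) = 0" by (simp add: cdiff_null_def)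
  finally show ?thesis by simp
qed

text \<open>
  This is the result of replacing \<open>y\<^sup>m\<close> by the \<open>m\<close>-th derivative of \<open>exp (b x) G(x)\<close> at \<open>x = 0\<close> in the
  expansion of \<open>S(y L(t))\<close>. In particular \<open>G = 1\<close> gives \<open>S(b L(t))\<close>, and averaging over \<open>b \<plusminus> 1\<close>
  multiplies \<open>G\<close> by \<open>cosh\<close>.
\<close>

definition kernel :: "real fps \<Rightarrow> real fps \<Rightarrow> real \<Rightarrow> real fps" where
  "kernel S G b = Abs_fps (\<lambda>m. S $ m * fact m * (fps_exp b * G) $ m) oo L_series"

text \<open>Since L has no constant term, coefficient \<open>i\<close> involves only the
  coefficients \<open>m \<le> i\<close> of exp(b x) G(x), each controlled by
  \<open>cdiff_null_exp\<close>.\<close>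

lemma shift_filtered_kernel: "shift_filtered 0 (\<lambda>b. Y * kernel S G b)"
  unfolding shift_filtered_def
proof
  fix i
  have "cdiff_null (i + 1) (\<lambda>b. kernel S G b $ (i - a))" for a
  proof -
    have "cdiff_null (i + 1) (\<lambda>b. (S $ m * fact m * L_series ^ m $ (i - a)) * (fps_exp b * G) $ m)"
      if "m \<in> {0..i - a}" for m
      using that by (intro cdiff_null_cmult cdiff_null_mono[OF cdiff_null_exp]) auto
    hence "cdiff_null (i + 1) (\<lambda>b. \<Sum>m=0..i - a. (S $ m * fact m * L_series ^ m $ (i - a)) * (fps_exp b * G) $ m)"
      by (rule cdiff_null_sum)
    thus ?thesis
      by (simp add: kernel_def fps_compose_nth mult_ac)
  qed
  hence "cdiff_null (i + 1) (\<lambda>b. \<Sum>a=0..i. Y $ a * kernel S G b $ (i - a))"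
    by (intro cdiff_null_sum cdiff_null_cmult)
  thus "cdiff_null (i + 1 - 0) (\<lambda>b. (Y * kernel S G b) $ i)"
    by (simp add: fps_mult_nth)
qed

text \<open>The kernel depends on \<open>b\<close> and \<open>G\<close> only through the product
  exp(b x) G(x), and linearly.\<close>

lemma kernel_lincomb:
  assumes "fps_exp b * H = fps_const a * (fps_exp b1 * G) + fps_const c * (fps_exp b2 * G)"
  shows "kernel S H b = fps_const a * kernel S G b1 + fps_const c * kernel S G b2"
proof -
  define f g where "f = fps_exp b1 * G" and "g = fps_exp b2 * G"
  show ?thesis
    unfolding kernel_def assms f_def[symmetric] g_def[symmetric]
    by (simp add: fps_eq_iff fps_compose_nth sum_distrib_left sum.distrib[symmetric] algebra_simps)
qed

text \<open>Shows how to invert \<open>shift_mean X\<close> on kernels: divide by \<open>X\<close>,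
  and divide \<open>G\<close> by cosh.\<close>

lemma shift_mean_kernel:
  assumes "X $ 0 = 1"
  shows "shift_mean X (\<lambda>b. inverse X * kernel S G b) b = kernel S (G * fps_cosh 1) b"
proof -
  have inv: "X * inverse X = 1" using assms by (simp add: inverse_mult_eq_1')
  have "shift_mean X (\<lambda>b. inverse X * kernel S G b) b =
      X * inverse X * (fps_const (1/2) * kernel S G (b + 1) + fps_const (1/2) * kernel S G (b - 1))"
    by (simp add: shift_mean_def algebra_simps)
  also have "\<dots> = kernel S (G * fps_cosh 1) b"
    unfolding inv by (subst kernel_lincomb) (simp_all add: distrib_left flip: shift_mean_exp)
  finally show ?thesis .
qed

lemma kernel_1: "kernel S 1 b = (S oo fps_const b * fps_X) oo L_series"
  unfolding kernel_def fps_compose_linear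
  by (intro arg_cong[where f = "\<lambda>f. f oo L_series"]) (simp add: fps_eq_iff)

text \<open>Half the difference of the two shifts multiplies exp(b x) by sinh x; this matches
  \<open>zigzag_base_odd\<close>.\<close>

lemma kernel_sinh:
  "kernel S (fps_sinh 1) b = fps_const (1/2) * (kernel S 1 (b + 1) - kernel S 1 (b - 1))"
proof -
  have neg: "fps_const (- 1/2 :: real) = - fps_const (1/2)" by simp
  have "fps_exp b * fps_sinh 1 =
      fps_const (1/2) * (fps_exp (b + 1) * 1) + fps_const (- 1/2) * (fps_exp (b - 1) * 1)"
    unfolding fps_exp_shift fps_sinh_def neg by (simp add: algebra_simps del: fps_const_neg)
  from kernel_lincomb[OF this] show ?thesis
    unfolding neg by (simp add: algebra_simps del: fps_const_neg)
qed

section \<open>Euler numbers and hyperbolic series\<close>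

text \<open>Each coefficient of the partial sums is eventually constant, because
  \<open>g ^ m\<close> has no terms below degree \<open>m\<close>.\<close>

lemma fps_compose_sums:
  fixes a g :: "real fps"
  assumes "g $ 0 = 0"
  shows "(\<lambda>m. fps_const (a $ m) * g ^ m) sums (a oo g)"
  unfolding sums_def
proof (rule tendsto_fpsI)
  fix n
  have "(\<Sum>m<N. fps_const (a $ m) * g ^ m) $ n = (a oo g) $ n" if N: "N > n" for N
  proof -
    have "(\<Sum>m<N. fps_const (a $ m) * g ^ m) $ n = (\<Sum>m<N. a $ m * g ^ m $ n)"
      by (simp add: fps_sum_nth)
    also have "\<dots> = (\<Sum>m=0..n. a $ m * g ^ m $ n)"
      using N startsby_zero_power_prefix[OF assms] by (intro sum.mono_neutral_right) auto
    finally show ?thesis by (simp add: fps_compose_nth)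
  qed
  thus "\<forall>\<^sub>F N in sequentially. (\<Sum>m<N. fps_const (a $ m) * g ^ m) $ n = (a oo g) $ n"
    unfolding eventually_sequentially by (intro exI[of _ "Suc n"]) auto
qed

text \<open>The substitution \<open>x \<mapsto> i x\<close> without complex numbers: odd coefficients are divided by \<open>i\<close>.\<close>

definition quarter_turn :: "real fps \<Rightarrow> real fps" where
  "quarter_turn f = Abs_fps (\<lambda>n. (-1) ^ (n div 2) * f $ n)"

text \<open>Floored halving is additive over \<open>i\<close> and \<open>n - i\<close> when
  \<open>i\<close> is even, and the terms with odd \<open>i\<close> vanish because \<open>f\<close>
  is even.\<close>

lemma quarter_turn_mult:
  assumes "\<And>n. odd n \<Longrightarrow> f $ n = 0"
  shows "quarter_turn (f * g) = quarter_turn f * quarter_turn g"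
proof (rule fps_ext)
  fix n
  have h: "(-1) ^ (n div 2) * (f $ i * g $ (n - i)) =
      (-1) ^ (i div 2) * f $ i * ((-1) ^ ((n - i) div 2) * g $ (n - i))" if "i \<le> n" for i
  proof (cases "even i")
    case True
    have "n div 2 = i div 2 + (n - i) div 2"
      using True that by (metis add.commute div_plus_div_distrib_dvd_left le_add_diff_inverse)
    thus ?thesis by (simp add: power_add)
  qed (simp add: assms)
  show "quarter_turn (f * g) $ n = (quarter_turn f * quarter_turn g) $ n"
    unfolding quarter_turn_def fps_mult_nth fps_nth_Abs_fps sum_distrib_left
    by (intro sum.cong refl h) auto
qed

lemma quarter_turn_cos: "quarter_turn (fps_cos 1) = fps_cosh 1"
  by (rule fps_ext) (auto simp: quarter_turn_def fps_cos_def fps_cosh_nth simp flip: power_add mult_2)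

lemma quarter_turn_sin: "quarter_turn (fps_sin 1) = fps_sinh 1"
  by (rule fps_ext) (auto simp: quarter_turn_def fps_sin_def fps_sinh_nth elim!: oddE simp flip: power_add mult_2)

text \<open>Turning the equations cos sec = 1 and cos tan = sin gives those that determine sech and
  tanh after cancelling cosh.\<close>

lemma quarter_turn_sec_tan:
  "quarter_turn (inverse (fps_cos 1)) = fps_sech" "quarter_turn (fps_tan 1) = fps_tanh"
proof -
  have odd: "fps_cos (1::real) $ n = 0" if "odd n" for n using that by (simp add: fps_cos_def)
  have inv: "fps_cos 1 * inverse (fps_cos 1) = (1 :: real fps)"
    by (rule inverse_mult_eq_1') simp
  have c0: "fps_cosh 1 \<noteq> 0" using fps_cosh_sech by auto
  have "quarter_turn 1 = 1" by (auto simp: quarter_turn_def fps_eq_iff)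
  hence "fps_cosh 1 * quarter_turn (inverse (fps_cos 1)) = 1"
    using quarter_turn_mult[OF odd, of "inverse (fps_cos 1)"] by (simp add: inv quarter_turn_cos)
  thus "quarter_turn (inverse (fps_cos 1)) = fps_sech"
    using fps_cosh_sech c0 by (metis mult_left_cancel)
  have "fps_cos 1 * fps_tan 1 = fps_sin (1::real)"
    unfolding fps_tan_def by (subst fps_divide_unit) (simp_all add: inv mult.left_commute)
  hence "fps_cosh 1 * quarter_turn (fps_tan 1) = fps_sinh 1"
    using quarter_turn_mult[OF odd, of "fps_tan 1"] by (simp add: quarter_turn_cos quarter_turn_sin)
  thus "quarter_turn (fps_tan 1) = fps_tanh"
    using fps_cosh_tanh c0 by (metis mult_left_cancel)
qed

section \<open>Parity of the series\<close>

abbreviation reflect :: "real fps \<Rightarrow> real fps" where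
  "reflect f \<equiv> f oo fps_const (-1) * fps_X"

lemma reflect_nth: "reflect f $ n = (-1) ^ n * f $ n"
  unfolding fps_compose_linear by simp

lemma reflect_parity:
  "reflect f = f \<Longrightarrow> odd n \<Longrightarrow> f $ n = 0" "reflect f = - f \<Longrightarrow> even n \<Longrightarrow> f $ n = 0"
  using reflect_nth[of f n] by auto

lemma reflect_cosh_mult: "reflect (fps_cosh 1 * f) = fps_cosh 1 * reflect f"
proof -
  have "reflect (fps_cosh 1) = fps_cosh 1"
    by (rule fps_ext) (simp add: reflect_nth fps_cosh_nth)
  thus ?thesis using fps_compose_mult_distrib[of "fps_const (-1) * fps_X" "fps_cosh 1" f] by simp
qed

lemma fps_cosh_cancel: "fps_cosh 1 * f = fps_cosh 1 * g \<Longrightarrow> f = g"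
  using fps_cosh_sech by (metis mult_left_cancel mult_zero_left zero_neq_one)

text \<open>As cosh is even and can be cancelled, sech inherits the parity of 1.\<close>

lemma fps_sech_odd: "odd n \<Longrightarrow> fps_sech $ n = 0"
proof (rule reflect_parity(1))
  have "fps_cosh 1 * reflect fps_sech = fps_cosh 1 * fps_sech"
    unfolding reflect_cosh_mult[symmetric] fps_cosh_sech by simp
  thus "reflect fps_sech = fps_sech" by (rule fps_cosh_cancel)
qed

lemma fps_tanh_even: "even n \<Longrightarrow> fps_tanh $ n = 0"
proof (rule reflect_parity(2))
  have "reflect (fps_sinh 1) = - fps_sinh 1"
    by (rule fps_ext) (simp add: reflect_nth fps_sinh_nth)
  hence "fps_cosh 1 * reflect fps_tanh = fps_cosh 1 * (- fps_tanh)"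
    unfolding reflect_cosh_mult[symmetric] mult_minus_right fps_cosh_tanh .
  thus "reflect fps_tanh = - fps_tanh" by (rule fps_cosh_cancel)
qed

lemma reflect_L_series: "reflect L_series = - L_series"
  by (rule fps_ext) (simp add: reflect_nth L_series_nth)

lemma reflect_compose_L:
  "reflect (f oo L_series) = f oo (- L_series)"
  unfolding reflect_L_series[symmetric] by (rule fps_compose_assoc[symmetric]) simp_all

text \<open>Only even powers of the odd series L occur, since sech is even.\<close>

lemma kernel_sech_odd: "odd n \<Longrightarrow> kernel fps_sech G 0 $ n = 0"
proof (rule reflect_parity(1))
  have *: "fps_sech $ i * c * (- L_series) ^ i $ n = fps_sech $ i * c * L_series ^ i $ n" for i n c
    by (cases "even i") (auto simp: fps_sech_odd power_minus_even)
  show "reflect (kernel fps_sech G 0) = kernel fps_sech G 0"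
    unfolding kernel_def reflect_compose_L
    by (rule fps_ext) (simp add: fps_compose_nth mult.assoc[of "fps_sech $ _" "fact _"] *)
qed

lemma kernel_tanh_even: "even n \<Longrightarrow> kernel fps_tanh G 0 $ n = 0"
proof (rule reflect_parity(2))
  have *: "fps_tanh $ i * c * (- L_series) ^ i $ n = - (fps_tanh $ i * c * L_series ^ i $ n)" for i n c
    by (cases "even i") (auto simp: fps_tanh_even power_minus_odd)
  show "reflect (kernel fps_tanh G 0) = - kernel fps_tanh G 0"
    unfolding kernel_def reflect_compose_L
    by (rule fps_ext) (simp add: fps_compose_nth mult.assoc[of "fps_tanh $ _" "fact _"] * sum_negf)
qed

text \<open>A square root is determined up to sign, and the constant term 1 settles the
  sign.\<close>

lemma reflect_root_series: "reflect root_series = root_series"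
proof -
  define U where "U = root_series"
  have sq: "U\<^sup>2 = 1 - fps_X\<^sup>2" and U0: "U $ 0 = 1"
    using fps_radical_one_minus_X_square unfolding U_def by blast+
  have "(reflect U)\<^sup>2 = reflect (U\<^sup>2)"
    by (rule fps_compose_power) simp
  also have "\<dots> = U\<^sup>2"
    unfolding sq by (rule fps_ext) (simp add: reflect_nth fps_X_power_nth)
  finally have "reflect U = U \<or> reflect U = - U"
    by (simp only: power2_eq_iff)
  moreover have "reflect U $ 0 \<noteq> (- U) $ 0"
    using U0 by (simp add: reflect_nth)
  ultimately show ?thesis unfolding U_def by metis
qed

lemma reflect_inverse_root_series: "reflect (inverse root_series) = inverse root_series"
  using fps_inverse_compose[of "fps_const (-1) * fps_X" root_series] root_series_nth_0
  by (simp add: reflect_root_series)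

lemma even_series_odd:
  assumes "odd n"
  shows "(inverse root_series * kernel fps_sech fps_sech 0) $ n = 0"
  unfolding fps_mult_nth
proof (rule sum.neutral, rule ballI)
  fix i assume "i \<in> {0..n}"
  hence "odd i \<or> odd (n - i)" using assms by auto
  thus "inverse root_series $ i * kernel fps_sech fps_sech 0 $ (n - i) = 0"
    by (elim disjE) (simp_all add: kernel_sech_odd reflect_parity(1)[OF reflect_inverse_root_series])
qed

text \<open>Only one of sec and tan contributes in each degree, and the sign introduced by
  \<open>quarter_turn\<close> disappears on squaring.\<close>

lemma euler_number_squared:
  "(euler_number n)\<^sup>2 / fact n = fact n * (if even n then fps_sech $ n else fps_tanh $ n)\<^sup>2"
proof -
  let ?s = "inverse (fps_cos 1 :: real fps) $ n" and ?t = "fps_tan (1::real) $ n"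
  have s: "fps_sech $ n = (-1) ^ (n div 2) * ?s" and t: "fps_tanh $ n = (-1) ^ (n div 2) * ?t"
    by (simp_all flip: quarter_turn_sec_tan add: quarter_turn_def)
  have "(?s + ?t)\<^sup>2 = (if even n then fps_sech $ n else fps_tanh $ n)\<^sup>2"
  proof (cases "even n")
    case True
    hence "?t = 0" using fps_tanh_even[of n] t by simp
    thus ?thesis using True s by (simp add: power_mult_distrib flip: power_mult)
  next
    case False
    hence "?s = 0" using fps_sech_odd[of n] s by simp
    thus ?thesis using False t by (simp add: power_mult_distrib flip: power_mult)
  qed
  moreover have "(euler_number n)\<^sup>2 / fact n = fact n * (?s + ?t)\<^sup>2"
    by (simp add: euler_number_def power_mult_distrib power2_eq_square)
  ultimately show ?thesis by simp
qed

text \<open>At \<open>b = 0\<close> the power \<open>L_series ^ m\<close> carries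
  \<open>S $ m\<close> times the \<open>m\<close>-th derivative of \<open>S\<close> at 0; this is
  the source of the squared Euler numbers.\<close>

lemma kernel_diagonal_sums:
  "(\<lambda>m. fps_const (fact m * (S $ m)\<^sup>2) * L_series ^ m) sums kernel S S 0"
  using fps_compose_sums[of L_series "Abs_fps (\<lambda>m. S $ m * fact m * S $ m)"]
  by (simp add: kernel_def power2_eq_square mult_ac)

lemma euler_even_sums:
  "(\<lambda>r. fps_const ((euler_number (2*r))\<^sup>2 / fact (2*r)) * L_series ^ (2*r)) sums kernel fps_sech fps_sech 0"
proof -
  have z: "fps_sech $ m = 0" if "m \<notin> range (\<lambda>r. 2 * r)" for m
    using that by (intro fps_sech_odd) (auto elim!: evenE)
  have "(\<lambda>r. fps_const (fact (2*r) * (fps_sech $ (2*r))\<^sup>2) * L_series ^ (2*r)) sums kernel fps_sech fps_sech 0"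
    by (subst sums_mono_reindex[where g = "\<lambda>r. 2 * r" and
          f = "\<lambda>m. fps_const (fact m * (fps_sech $ m)\<^sup>2) * L_series ^ m"])
       (auto simp: strict_mono_def kernel_diagonal_sums z simp del: fps_const_mult)
  thus ?thesis by (simp only: euler_number_squared) simp
qed

lemma euler_odd_sums:
  "(\<lambda>r. fps_const ((euler_number (2*r+1))\<^sup>2 / fact (2*r+1)) * L_series ^ (2*r+1)) sums kernel fps_tanh fps_tanh 0"
proof -
  have z: "fps_tanh $ m = 0" if "m \<notin> range (\<lambda>r. 2 * r + 1)" for m
    using that by (cases "even m") (auto elim!: oddE simp: fps_tanh_even)
  have "(\<lambda>r. fps_const (fact (2*r+1) * (fps_tanh $ (2*r+1))\<^sup>2) * L_series ^ (2*r+1)) sums kernel fps_tanh fps_tanh 0"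
    by (subst sums_mono_reindex[where g = "\<lambda>r. 2 * r + 1" and
          f = "\<lambda>m. fps_const (fact m * (fps_tanh $ m)\<^sup>2) * L_series ^ m"])
       (auto simp: strict_mono_def kernel_diagonal_sums z simp del: fps_const_mult)
  thus ?thesis by (simp only: euler_number_squared) simp
qed

section \<open>Counting permutations\<close>

text \<open>The inverse is always reverse alternating; \<open>w\<close> is reverse alternating for
  \<open>s = True\<close> and alternating for \<open>s = False\<close>.\<close>

definition pattern_count :: "bool \<Rightarrow> nat \<Rightarrow> nat" where
  "pattern_count s n =
     card {w. w permutes {1..n} \<and> ascent_pattern s n w \<and> ascent_pattern True n (inv w)}"

lemma length_positions [simp]: "length (positions n w) = n"
  by (simp add: positions_def)

lemma zigzag_positions: "zigzag (<) (positions n w) \<longleftrightarrow> ascent_pattern True n (inv w)"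
proof -
  have "positions n w ! (i - 1) = inv w i" "positions n w ! i = inv w (Suc i)" if "1 \<le> i" "i < n" for i
  proof -
    have "i - 1 < n" "Suc (i - 1) = i" using that by auto
    thus "positions n w ! (i - 1) = inv w i" "positions n w ! i = inv w (Suc i)"
      using that by (simp_all add: positions_def del: upt_Suc)
  qed
  thus ?thesis unfolding zigzag_iff_nth ascent_pattern_def by auto
qed

lemma signed_standardization:
  "(\<Sum>w | w permutes {1..n}. ((-1) ^ (n div 2) * of_bool (ascent_pattern s n w)) *
       foldr (chain_op (<)) ys nil_ind (positions n w)) =
   word_gf ys (zigzag_sign (ascent_rel s) (even n)) $ n"
proof -
  have "(\<Sum>w | w permutes {1..n}. ((-1) ^ (n div 2) * of_bool (ascent_pattern s n w)) *
       foldr (chain_op (<)) ys nil_ind (positions n w)) =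
    (-1) ^ (n div 2) * (\<Sum>u\<in>words (length ys) n. of_bool (zigzag (ascent_rel s) u) * word_weight ys u)"
    unfolding standardization[symmetric] sum_distrib_left by (simp add: mult_ac)
  also have "\<dots> = word_gf ys (zigzag_sign (ascent_rel s) (even n)) $ n"
    unfolding word_gf_def fps_nth_Abs_fps sum_distrib_left
    by (rule sum.cong) (auto simp: words_def zigzag_sign_def)
  finally show ?thesis .
qed

text \<open>The sign is inserted a second time, for \<open>w\<close> itself, so that it cancels the
  one in \<open>zigzag_sign\<close> for the inverse.\<close>

lemma real_pattern_count:
  "real (pattern_count s n) =
     (\<Sum>w | w permutes {1..n}. ((-1) ^ (n div 2) * of_bool (ascent_pattern s n w)) *
        zigzag_sign (<) (even n) (positions n w))"
proof -
  have "real (pattern_count s n) = (\<Sum>w\<in>{w \<in> {w. w permutes {1..n}}.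
      ascent_pattern s n w \<and> ascent_pattern True n (inv w)}. 1)"
    by (simp add: pattern_count_def)
  also have "\<dots> = (\<Sum>w | w permutes {1..n}. if ascent_pattern s n w \<and> ascent_pattern True n (inv w) then 1 else 0)"
    by (rule sum.inter_filter) (simp add: finite_permutations)
  also have "\<dots> = (\<Sum>w | w permutes {1..n}. ((-1) ^ (n div 2) * of_bool (ascent_pattern s n w)) *
        zigzag_sign (<) (even n) (positions n w))"
    by (rule sum.cong) (auto simp: zigzag_sign_def zigzag_positions simp flip: power_add mult_2)
  finally show ?thesis .
qed

text \<open>The pattern of the inverse is expanded into defects of the base, these are carried over
  to series in \<open>b\<close>, and the expansion is summed again there. The empty list of weights
  gives \<open>b = 0\<close>.\<close>

lemma pattern_count_transfer:
  assumes "\<And>ys. set ys \<subseteq> {1, -1} \<Longrightarrow>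
      (\<Sum>w | w permutes {1..n}. ((-1) ^ (n div 2) * of_bool (ascent_pattern s n w)) *
         foldr (chain_op (<)) ys (zigzag_base (<) (even n)) (positions n w)) =
      (X ^ length ys * shift_mean X \<Theta> (sum_list ys)) $ n"
    and "X $ 0 = 1" "shift_filtered 0 \<Theta>"
  shows "real (pattern_count s n) = \<Theta> 0 $ n"
proof -
  let ?c = "\<lambda>w. (-1) ^ (n div 2) * of_bool (ascent_pattern s n w) :: real"
  let ?B = "zigzag_base (<) (even n) :: nat list \<Rightarrow> real"
  have "real (pattern_count s n) =
      (\<Sum>w | w permutes {1..n}. \<Sum>r\<le>n. ?c w * (even_defect (<) ^^ r) ?B (positions n w))"
    unfolding real_pattern_count sum_distrib_left[symmetric]
    by (subst sum_even_defect_base) auto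
  also have "\<dots> = (\<Sum>r\<le>n. \<Sum>w | w permutes {1..n}. ?c w * (even_defect (<) ^^ r) ?B (positions n w))"
    by (rule sum.swap)
  also have "\<dots> = (\<Sum>r\<le>n. (shift_defect X ^^ r) (shift_mean X \<Theta>) 0 $ n)"
    using transfer_defect[where ys = "[]" and c = ?c and v = "positions n", OF assms(1)]
    by (intro sum.cong refl) simp
  also have "\<dots> = \<Theta> 0 $ n" by (rule sum_shift_defect[OF assms(2,3)])
  finally show ?thesis .
qed

text \<open>The base \<open>nil_ind\<close> leads to sech(b L), the kernel with
  \<open>G = 1\<close>, times powers of the scale; inverting the mean replaces \<open>G\<close> by
  sech.\<close>

lemma pattern_count_even:
  assumes "even n"
  shows "real (pattern_count s n) = (inverse (ascent_scale s) * kernel fps_sech fps_sech 0) $ n"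
proof (rule pattern_count_transfer[where X = "ascent_scale s"
      and \<Theta> = "\<lambda>b. inverse (ascent_scale s) * kernel fps_sech fps_sech b"])
  fix ys :: "real list" assume ys: "set ys \<subseteq> {1, -1}"
  have b: "zigzag_base (<) (even n) = (nil_ind :: nat list \<Rightarrow> real)"
    using assms by (auto simp: zigzag_base_def)
  have "fps_sech * fps_cosh 1 = 1" using fps_cosh_sech by (simp add: mult.commute)
  thus "(\<Sum>w | w permutes {1..n}. (- 1) ^ (n div 2) * of_bool (ascent_pattern s n w) *
           foldr (chain_op (<)) ys (zigzag_base (<) (even n)) (positions n w)) =
        (ascent_scale s ^ length ys *
           shift_mean (ascent_scale s) (\<lambda>b. inverse (ascent_scale s) * kernel fps_sech fps_sech b) (sum_list ys)) $ n"
    unfolding b signed_standardization using assms word_gf_zigzag_sign(1)[OF ys]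
    by (simp add: shift_mean_kernel kernel_1)
qed (simp_all add: shift_filtered_kernel)

text \<open>The odd base turns tanh(b L) into the kernel with \<open>G\<close> equal to sinh, which
  is tanh times cosh; inverting the mean leaves \<open>G\<close> equal to tanh. The zigzag series
  for odd length carries no scale, hence \<open>X = 1\<close>.\<close>

lemma pattern_count_odd:
  assumes "odd n"
  shows "real (pattern_count s n) = kernel fps_tanh fps_tanh 0 $ n"
proof -
  have "real (pattern_count s n) = (inverse 1 * kernel fps_tanh fps_tanh 0) $ n"
  \<comment> \<open>The factor \<open>inverse 1\<close> is kept to match the form of
    \<open>shift_mean_kernel\<close>.\<close>
  proof (rule pattern_count_transfer[where X = 1 and \<Theta> = "\<lambda>b. inverse 1 * kernel fps_tanh fps_tanh b"])
    fix ys :: "real list" assume ys: "set ys \<subseteq> {1, -1}"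
    let ?c = "\<lambda>w. (-1) ^ (n div 2) * of_bool (ascent_pattern s n w) :: real"
    let ?F = "\<lambda>ys. \<Sum>w | w permutes {1..n}. ?c w * foldr (chain_op (<)) ys nil_ind (positions n w)"
    have F: "?F zs = kernel fps_tanh 1 (sum_list zs) $ n" if "set zs \<subseteq> {1, -1}" for zs
      unfolding signed_standardization kernel_1 using assms word_gf_zigzag_sign(2)[OF that, of s] by simp
    have b: "zigzag_base (<) (even n) =
        (\<lambda>v :: nat list. (chain_op (<) 1 nil_ind v - chain_op (<) (-1) nil_ind v) / 2)"
      using assms by (simp add: fun_eq_iff zigzag_base_odd)
    have "(\<Sum>w | w permutes {1..n}. ?c w * foldr (chain_op (<)) ys (zigzag_base (<) (even n)) (positions n w)) =
        (?F (ys @ [1]) - ?F (ys @ [-1])) / 2"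
      unfolding b foldr_chain_op_half_diff
      by (simp add: right_diff_distrib sum_subtractf sum_divide_distrib diff_divide_distrib)
    also have "\<dots> = kernel fps_tanh (fps_sinh 1) (sum_list ys) $ n"
    proof -
      have "?F (ys @ [1]) = kernel fps_tanh 1 (sum_list ys + 1) $ n"
        and "?F (ys @ [-1]) = kernel fps_tanh 1 (sum_list ys - 1) $ n"
        using ys F[of "ys @ [1]"] F[of "ys @ [-1]"] by simp_all
      thus ?thesis unfolding kernel_sinh by simp
    qed
    also have "fps_sinh 1 = fps_tanh * fps_cosh 1"
      using fps_cosh_tanh by (simp add: mult.commute)
    finally show "(\<Sum>w | w permutes {1..n}. ?c w *
          foldr (chain_op (<)) ys (zigzag_base (<) (even n)) (positions n w)) =
        (1 ^ length ys * shift_mean 1 (\<lambda>b. inverse 1 * kernel fps_tanh fps_tanh b) (sum_list ys)) $ n"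
      by (simp only: shift_mean_kernel fps_one_nth if_True power_one mult_1_left simp_thms)
  qed (use shift_filtered_kernel[of "inverse 1"] in simp_all)
  thus ?thesis by simp
qed

section \<open>Reversal and complement of permutations\<close>

lemma alternating_iff:
  assumes "w permutes {1..n}"
  shows "alternating n w \<longleftrightarrow> ascent_pattern False n w"
    and "reverse_alternating n w \<longleftrightarrow> ascent_pattern True n w"
proof -
  have "w i \<noteq> w (Suc i)" for i
    using permutes_inj[OF assms] by (metis injD n_not_Suc_n)
  hence "w i < w (Suc i) \<longleftrightarrow> \<not> w (Suc i) < w i" for i by (metis less_asym linorder_neqE_nat)
  thus "alternating n w \<longleftrightarrow> ascent_pattern False n w"
    "reverse_alternating n w \<longleftrightarrow> ascent_pattern True n w"
    unfolding alternating_def reverse_alternating_def ascent_pattern_def by auto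
qed

text \<open>Fixes everything outside the range from 1 to \<open>n\<close>, as
  \<open>permutes\<close> demands.\<close>

definition flip :: "nat \<Rightarrow> nat \<Rightarrow> nat" where
  "flip n i = (if i \<in> {1..n} then n + 1 - i else i)"

lemma flip_flip [simp]: "flip n \<circ> flip n = id" "flip n (flip n i) = i"
  by (auto simp: flip_def fun_eq_iff)

lemma flip_permutes: "flip n permutes {1..n}"
  by (rule bij_imp_permutes, rule bij_betwI[where g = "flip n"]) (auto simp: flip_def)

lemma inv_flip [simp]: "inv (flip n) = flip n"
  by (rule inv_unique_comp) simp_all

lemma ascent_pattern_flip_left:
  assumes "w permutes {1..n}"
  shows "ascent_pattern s n (flip n \<circ> w) \<longleftrightarrow> ascent_pattern (\<not> s) n w"
proof -
  have "flip n (w i) < flip n (w (Suc i)) \<longleftrightarrow> \<not> w i < w (Suc i)" if "1 \<le> i" "i < n" for i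
  proof -
    have "w i \<in> {1..n}" "w (Suc i) \<in> {1..n}"
      using that by (simp_all only: permutes_in_image[OF assms]) auto
    moreover have "w i \<noteq> w (Suc i)"
      using permutes_inj[OF assms] by (metis injD n_not_Suc_n)
    ultimately show ?thesis by (auto simp: flip_def)
  qed
  thus ?thesis by (auto simp: ascent_pattern_def)
qed

text \<open>Step \<open>i\<close> of the reversed word is step \<open>n - i\<close> read backwards:
  ascents become descents, and the parity of the step changes exactly when \<open>n\<close> is
  odd.\<close>

lemma ascent_pattern_flip_right:
  assumes "w permutes {1..n}"
  shows "ascent_pattern s n (w \<circ> flip n) \<longleftrightarrow> ascent_pattern (s = odd n) n w"
proof -
  have key: "w (flip n i) < w (flip n (Suc i)) \<longleftrightarrow> \<not> w (n - i) < w (Suc (n - i))"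
    if "1 \<le> i" "i < n" for i
  proof -
    have "flip n i = Suc (n - i)" "flip n (Suc i) = n - i" using that by (auto simp: flip_def)
    moreover have "w (n - i) \<noteq> w (Suc (n - i))"
      using permutes_inj[OF assms] by (metis injD n_not_Suc_n)
    ultimately show ?thesis by auto
  qed
  have "ascent_pattern s n (w \<circ> flip n) \<longleftrightarrow>
      (\<forall>i. 1 \<le> i \<and> i < n \<longrightarrow> (w (n - i) < w (Suc (n - i)) \<longleftrightarrow> odd (n - i) = (s = odd n)))"
    unfolding ascent_pattern_def using key by auto
  also have "\<dots> \<longleftrightarrow> (\<forall>j. 1 \<le> j \<and> j < n \<longrightarrow> (w j < w (Suc j) \<longleftrightarrow> odd j = (s = odd n)))"
  proof (rule iffI; intro allI impI)
    fix j assume *: "\<forall>i. 1 \<le> i \<and> i < n \<longrightarrow> (w (n - i) < w (Suc (n - i)) \<longleftrightarrow> odd (n - i) = (s = odd n))"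
      and j: "1 \<le> j \<and> j < n"
    from j have "1 \<le> n - j" "n - j < n" "n - (n - j) = j" by auto
    with *[rule_format, of "n - j"] show "w j < w (Suc j) \<longleftrightarrow> odd j = (s = odd n)" by simp
  qed auto
  finally show ?thesis by (simp add: ascent_pattern_def)
qed

lemma bialt_count_star_eq: "bialt_count_star n = pattern_count False n"
  unfolding bialt_count_star_def pattern_count_def
  by (rule arg_cong[where f = card]) (auto simp: alternating_iff permutes_inv)

lemma bialt_count_alt:
  "bialt_count n = card {w. w permutes {1..n} \<and> ascent_pattern False n w \<and> ascent_pattern False n (inv w)}"
  unfolding bialt_count_def
  by (rule arg_cong[where f = card]) (auto simp: alternating_iff permutes_inv)

lemma inv_comp_permutes:
  "v permutes S \<Longrightarrow> w permutes S \<Longrightarrow> inv (v \<circ> w) = inv w \<circ> inv v"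
  by (rule o_inv_distrib) (auto dest: permutes_bij)

text \<open>The involution \<open>h\<close> complements both patterns. For even \<open>n\<close>,
  complementing \<open>w\<close> reverses the word of its inverse, which complements that pattern
  too; for odd \<open>n\<close>, reversal keeps patterns, so complementing and reversing affects
  \<open>w\<close> and its inverse alike.\<close>

lemma bialt_count_eq: "bialt_count n = pattern_count True n"
proof -
  define h where "h w = (if even n then flip n \<circ> w else flip n \<circ> w \<circ> flip n)" for w
  have hh: "h (h w) = w" for w by (auto simp: h_def fun_eq_iff)
  have h: "h w permutes {1..n}" "ascent_pattern s n (h w) \<longleftrightarrow> ascent_pattern (\<not> s) n w"
    "ascent_pattern s n (inv (h w)) \<longleftrightarrow> ascent_pattern (\<not> s) n (inv w)" if w: "w permutes {1..n}" for w s
  proof -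
    note f = flip_permutes[of n] and i = permutes_inv[OF w]
    note fw = permutes_compose[OF w f]
    show "h w permutes {1..n}" unfolding h_def using permutes_compose[OF f fw] fw by simp
    show "ascent_pattern s n (h w) \<longleftrightarrow> ascent_pattern (\<not> s) n w"
      unfolding h_def using ascent_pattern_flip_left[OF w] ascent_pattern_flip_right[OF fw] by simp
    have "inv (h w) = (if even n then inv w \<circ> flip n else flip n \<circ> inv w \<circ> flip n)"
      using inv_comp_permutes[OF f w] inv_comp_permutes[OF fw f] by (simp add: h_def comp_assoc)
    thus "ascent_pattern s n (inv (h w)) \<longleftrightarrow> ascent_pattern (\<not> s) n (inv w)"
      using ascent_pattern_flip_left[OF i] ascent_pattern_flip_right[OF i]
        ascent_pattern_flip_right[OF permutes_compose[OF i f]] by simp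
  qed
  show ?thesis
    unfolding bialt_count_alt pattern_count_def
    by (rule bij_betw_same_card[of h], rule bij_betwI[where g = h]) (auto simp: h hh simp del: One_nat_def)
qed

text \<open>For odd \<open>n\<close> the reversed word of an alternating permutation is again alternating.\<close>

lemma bialt_count_star_odd:
  assumes "odd n"
  shows "bialt_count_star n = bialt_count n"
proof -
  define h where "h w = inv w \<circ> flip n" for w :: "nat \<Rightarrow> nat"
  have h: "h w permutes {1..n}" "ascent_pattern s n (h w) \<longleftrightarrow> ascent_pattern s n (inv w)"
    "ascent_pattern s n (inv (h w)) \<longleftrightarrow> ascent_pattern (\<not> s) n w" "inv (h w) = flip n \<circ> w"
    if w: "w permutes {1..n}" for w s
  proof -
    note f = flip_permutes[of n] and i = permutes_inv[OF w]
    show "h w permutes {1..n}" unfolding h_def by (rule permutes_compose[OF f i])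
    show inv: "inv (h w) = flip n \<circ> w"
      unfolding h_def inv_comp_permutes[OF i f] by (simp add: permutes_inv_inv[OF w])
    show "ascent_pattern s n (h w) \<longleftrightarrow> ascent_pattern s n (inv w)"
      unfolding h_def ascent_pattern_flip_right[OF i] using assms by simp
    show "ascent_pattern s n (inv (h w)) \<longleftrightarrow> ascent_pattern (\<not> s) n w"
      unfolding inv by (rule ascent_pattern_flip_left[OF w])
  qed
  \<comment> \<open>Complementing the inverse makes its reverse alternating pattern alternating; the
    inverse of \<open>k w\<close> is the reversal of \<open>w\<close>, whose pattern is
    kept.\<close>
  define k where "k w = flip n \<circ> inv w" for w :: "nat \<Rightarrow> nat"
  have k: "k w permutes {1..n}" "ascent_pattern s n (k w) \<longleftrightarrow> ascent_pattern (\<not> s) n (inv w)"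
    "ascent_pattern s n (inv (k w)) \<longleftrightarrow> ascent_pattern s n w" "h (k w) = w" "k (h w) = w"
    if w: "w permutes {1..n}" for w s
  proof -
    note f = flip_permutes[of n] and i = permutes_inv[OF w]
    show "k w permutes {1..n}" unfolding k_def by (rule permutes_compose[OF i f])
    have inv: "inv (k w) = w \<circ> flip n"
      unfolding k_def inv_comp_permutes[OF f i] by (simp add: permutes_inv_inv[OF w])
    show "h (k w) = w" unfolding h_def inv by (simp add: comp_assoc)
    show "k (h w) = w" unfolding k_def h(4)[OF w] by (simp flip: comp_assoc)
    show "ascent_pattern s n (k w) \<longleftrightarrow> ascent_pattern (\<not> s) n (inv w)"
      unfolding k_def by (rule ascent_pattern_flip_left[OF i])
    show "ascent_pattern s n (inv (k w)) \<longleftrightarrow> ascent_pattern s n w"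
      unfolding inv ascent_pattern_flip_right[OF w] using assms by simp
  qed
  show ?thesis
    unfolding bialt_count_alt bialt_count_star_eq pattern_count_def
    by (rule bij_betw_same_card[of k], rule bij_betwI[where g = h]) (auto simp: h(1-3) k simp del: One_nat_def)
qed

text \<open>The two generating functions are the same kernel divided and multiplied by
  \<open>root_series\<close>, so their ratio is 1 - t^2; its quadratic term shifts the index by
  2.\<close>

lemma bialt_count_star_even:
  assumes "k \<ge> 1"
  shows "int (bialt_count_star (2*k)) = int (bialt_count (2*k)) - int (bialt_count (2*k-2))"
proof -
  define S where "S = kernel fps_sech fps_sech 0"
  have U0: "root_series $ 0 \<noteq> 0" unfolding root_series_nth_0 by simp
  have f: "real (bialt_count n) = (inverse root_series * S) $ n" if "even n" for n
    using pattern_count_even[OF that, of True] by (simp add: bialt_count_eq ascent_scale_def S_def)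
  have "inverse (ascent_scale False) * S = root_series * S"
    using U0 by (simp add: ascent_scale_def fps_inverse_idempotent)
  also have "\<dots> = root_series\<^sup>2 * (inverse root_series * S)"
    using inverse_mult_eq_1'[OF U0] by (simp add: power2_eq_square mult.assoc flip: mult.assoc[of root_series "inverse root_series"])
  also have "\<dots> = inverse root_series * S - fps_X\<^sup>2 * (inverse root_series * S)"
    unfolding fps_radical_one_minus_X_square by (simp add: left_diff_distrib)
  finally have "real (bialt_count_star (2*k)) =
      (inverse root_series * S) $ (2*k) - (inverse root_series * S) $ (2*k-2)"
    using pattern_count_even[of "2*k" False] assms
    by (simp add: bialt_count_star_eq fps_X_power_mult_nth S_def)
  also have "\<dots> = real (bialt_count (2*k)) - real (bialt_count (2*k-2))"
    using f[of "2*k"] f[of "2*k-2"] by simp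
  finally have "real_of_int (int (bialt_count_star (2*k))) =
      real_of_int (int (bialt_count (2*k)) - int (bialt_count (2*k-2)))" by simp
  thus ?thesis by linarith
qed

theorem theorem3p1:
  shows
    "summable (\<lambda>r. fps_const ((euler_number (2*r+1))\<^sup>2 / fact (2*r+1)) * L_series ^ (2*r+1)) \<and>
     (Abs_fps (\<lambda>n. if odd n then real (bialt_count n) else 0) =
        (\<Sum>r. fps_const ((euler_number (2*r+1))\<^sup>2 / fact (2*r+1)) * L_series ^ (2*r+1))) \<and>
     (\<forall>k. bialt_count_star (2*k+1) = bialt_count (2*k+1)) \<and>
     summable (\<lambda>r. fps_const ((euler_number (2*r))\<^sup>2 / fact (2*r)) * L_series ^ (2*r)) \<and>
     (Abs_fps (\<lambda>n. if even n then real (bialt_count n) else 0) =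
        inverse (fps_radical root 2 (1 - fps_X\<^sup>2)) *
        (\<Sum>r. fps_const ((euler_number (2*r))\<^sup>2 / fact (2*r)) * L_series ^ (2*r))) \<and>
     (\<forall>k\<ge>1. int (bialt_count_star (2*k)) = int (bialt_count (2*k)) - int (bialt_count (2*k-2)))"
proof (intro conjI allI impI)
  show "summable (\<lambda>r. fps_const ((euler_number (2*r+1))\<^sup>2 / fact (2*r+1)) * L_series ^ (2*r+1))"
    by (rule sums_summable[OF euler_odd_sums])
  show "summable (\<lambda>r. fps_const ((euler_number (2*r))\<^sup>2 / fact (2*r)) * L_series ^ (2*r))"
    by (rule sums_summable[OF euler_even_sums])
  show "Abs_fps (\<lambda>n. if odd n then real (bialt_count n) else 0) =
        (\<Sum>r. fps_const ((euler_number (2*r+1))\<^sup>2 / fact (2*r+1)) * L_series ^ (2*r+1))"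
    unfolding sums_unique[OF euler_odd_sums, symmetric]
    by (rule fps_ext) (simp add: bialt_count_eq pattern_count_odd kernel_tanh_even)
  show "bialt_count_star (2*k+1) = bialt_count (2*k+1)" for k
    by (rule bialt_count_star_odd) simp
  show "int (bialt_count_star (2*k)) = int (bialt_count (2*k)) - int (bialt_count (2*k-2))" if "1 \<le> k" for k
    by (rule bialt_count_star_even[OF that])
  show "Abs_fps (\<lambda>n. if even n then real (bialt_count n) else 0) =
        inverse (fps_radical root 2 (1 - fps_X\<^sup>2)) *
        (\<Sum>r. fps_const ((euler_number (2*r))\<^sup>2 / fact (2*r)) * L_series ^ (2*r))"
    unfolding sums_unique[OF euler_even_sums, symmetric]
    using pattern_count_even[of _ True] even_series_odd
    by (intro fps_ext) (simp add: bialt_count_eq ascent_scale_def)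
qed

end
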